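(* Let $X$ be a complex Banach space and let $A_1 : D(A_1)\to X$ and $A_2 : D(A_2)\to X$ be linear operators whose domains $D(A_1), D(A_2)\subseteq X$ are dense in $X$. (a) Suppose that $A_1$ and $A_2$ are dissipative, that $A_2$ is bounded, that there exist $\lambda_1,\lambda_2>0$ such that the ranges satisfy $(\lambda_1 I-A_1)D(A_1)=(\lambda_2 I-A_2)D(A_2)=X$, and that $A_1A_2=A_2A_1$. Then $(A_1,A_2)$ is the infinitesimal generator of a two-parameter $C_0$-semigroup of contractions on $X$. (b) Suppose that $(A_1,A_2)$ is the infinitesimal generator of a two-parameter $C_0$-semigroup of contractions on $X$. Then $$(\lambda I-A_1)D(A_1)=(\lambda I-A_2)D(A_2)=X\quad\text{for all }\lambda>0,$$ and $A_1$ and $A_2$ are dissipative. Moreover, for every $x\in D(A_1)$, $y\in D(A_2)$, $x^*\in F(x)$ and $y^*\in F(y)$, $$\mathrm{Re}\,\langle A_1x,x^*\rangle\le 0\quad\text{and}\quad \mathrm{Re}\,\langle A_2y,y^*\rangle\le 0.$$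
   Context: Let $X$ be a complex Banach space, $B(X)$ the bounded linear operators on $X$, and $X^*$ the dual of $X$; $\langle x,x^*\rangle=\langle x^*,x\rangle$ denotes the value of $x^*\in X^*$ at $x\in X$. Linear operators are defined on linear subspaces of $X$ (their domains) and need not be bounded; a linear operator $A$ is bounded if there is $C\ge 0$ with $\|Ax\|\le C\|x\|$ for all $x\in D(A)$. Products: $A_1A_2$ has its natural domain $\{x\in D(A_2): A_2x\in D(A_1)\}$ and $A_2A_1$ has its natural domain $\{x\in D(A_1): A_1x\in D(A_2)\}$; $A_1A_2=A_2A_1$ means equality as linear operators (equal domains and equal values). Duality set: for $x\in X$, $F(x)=\{x^*\in X^* : \langle x^*,x\rangle=\|x\|^2=\|x^*\|^2\}$. Dissipative: a linear operator $A$ is dissipative if for every $x\in D(A)$ there is some $x^*\in F(x)$ with $\mathrm{Re}\,\langle Ax,x^*\rangle\le 0$. Two-parameter semigroup: with $\mathbb{R}_+=[0,\infty)$, a function $T:\mathbb{R}_+\times\mathbb{R}_+\to B(X)$ such that $T(0,0)=I$ and $T(s+s',t+t')=T(s,t)T(s',t')$ for all $s,s',t,t'\ge 0$. It is a (two-parameter) $C_0$-semigroup if it is strongly continuous, i.e. $(s,t)\mapsto T(s,t)x$ is continuous for every $x\in X$. It is a semigroup of contractions if $\|T(s,t)\|\le 1$ for all $s,t\ge 0$. Infinitesimal generator: for a two-parameter $C_0$-semigroup $T$, put $u(s)=T(s,0)$ and $v(t)=T(0,t)$; these are one-parameter $C_0$-semigroups and $T(s,t)=u(s)v(t)$. The infinitesimal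 generator of $T$ is the pair $(A_1,A_2)$, where $A_1$ and $A_2$ are the usual (one-parameter) infinitesimal generators of $u$ and $v$ respectively, i.e. $A_1x=\lim_{s\downarrow 0}(u(s)x-x)/s$ with domain the set of all $x$ for which the limit exists in norm, and similarly $A_2$ from $v$. *)

theory Defs
  imports "HOL-Analysis.Analysis"
begin

section \<open>Complex Banach spaces\<close>

text \<open>The library only has real normed spaces. A complex one is a real one with a complex scalar
  multiplication that extends the real scalar multiplication.\<close>

class complex_normed_vector = real_normed_vector +
  fixes scaleC :: "complex \<Rightarrow> 'a \<Rightarrow> 'a"  (infixr \<open>*\<^sub>C\<close> 75)
  assumes scaleC_add_right: "c *\<^sub>C (x + y) = c *\<^sub>C x + c *\<^sub>C y"
    and scaleC_add_left: "(c + d) *\<^sub>C x = c *\<^sub>C x + d *\<^sub>C x"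
    and scaleC_scaleC: "c *\<^sub>C d *\<^sub>C x = (c * d) *\<^sub>C x"
    and scaleC_of_real: "of_real r *\<^sub>C x = r *\<^sub>R x"
    and norm_scaleC: "norm (c *\<^sub>C x) = cmod c * norm x"

class complex_banach = complex_normed_vector + banach

interpretation complex_vector: vector_space "scaleC :: complex \<Rightarrow> 'a \<Rightarrow> 'a::complex_normed_vector"
proof
  show "1 *\<^sub>C x = x" for x :: 'a
    using scaleC_of_real[of 1 x] by simp
qed (simp_all add: scaleC_add_right scaleC_add_left scaleC_scaleC)

instantiation complex :: complex_banach
begin

definition "scaleC_complex = ((*) :: complex \<Rightarrow> complex \<Rightarrow> complex)"

instance
  by standard
    (simp_all add: scaleC_complex_def distrib_left distrib_right mult.assoc norm_mult scaleR_conv_of_real)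

end

section \<open>Linear operators and dissipativity\<close>

text \<open>An operator in \<open>X\<close> is a partial map, with domain \<open>dom A\<close> and value \<open>the (A x)\<close>. Equality of
  partial maps is equality of domains and of values, and \<open>A \<circ>\<^sub>m B\<close> is the product on its natural
  domain.\<close>

definition linear_operator :: "('a::complex_normed_vector \<rightharpoonup> 'a) \<Rightarrow> bool" where
  "linear_operator A \<longleftrightarrow>
     complex_vector.subspace (dom A) \<and>
     (\<forall>x\<in>dom A. \<forall>y\<in>dom A. the (A (x + y)) = the (A x) + the (A y)) \<and>
     (\<forall>c. \<forall>x\<in>dom A. the (A (c *\<^sub>C x)) = c *\<^sub>C the (A x))"

lemma dom_map_comp_natural: "dom (A \<circ>\<^sub>m B) = {x \<in> dom B. the (B x) \<in> dom A}"
  by (auto simp: dom_def map_comp_def split: option.splits)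

definition bounded_operator :: "('a::complex_normed_vector \<rightharpoonup> 'a) \<Rightarrow> bool" where
  "bounded_operator A \<longleftrightarrow> (\<exists>C\<ge>0. \<forall>x\<in>dom A. norm (the (A x)) \<le> C * norm x)"

definition shifted_range :: "real \<Rightarrow> ('a::complex_normed_vector \<rightharpoonup> 'a) \<Rightarrow> 'a set" where
  "shifted_range l A = (\<lambda>x. l *\<^sub>R x - the (A x)) ` dom A"

text \<open>Elements of type \<open>'a \<Rightarrow>\<^sub>L complex\<close> are real-linear, so complex linearity is required
  separately; the norm of \<open>X\<^sup>*\<close> is the norm of that type.\<close>

definition duality_set :: "'a::complex_normed_vector \<Rightarrow> ('a \<Rightarrow>\<^sub>L complex) set" where
  "duality_set x =
     {f. Vector_Spaces.linear (*\<^sub>C) (*\<^sub>C) (blinfun_apply f) \<and>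
         blinfun_apply f x = of_real ((norm x)\<^sup>2) \<and> (norm x)\<^sup>2 = (norm f)\<^sup>2}"

definition dissipative :: "('a::complex_normed_vector \<rightharpoonup> 'a) \<Rightarrow> bool" where
  "dissipative A \<longleftrightarrow> (\<forall>x\<in>dom A. \<exists>f\<in>duality_set x. Re (blinfun_apply f (the (A x))) \<le> 0)"

section \<open>Two-parameter semigroups\<close>

text \<open>Only the values \<open>T s t\<close> with \<open>s, t \<ge> 0\<close> are relevant.\<close>

definition two_parameter_semigroup ::
    "(real \<Rightarrow> real \<Rightarrow> 'a::complex_normed_vector \<Rightarrow>\<^sub>L 'a) \<Rightarrow> bool" where
  "two_parameter_semigroup T \<longleftrightarrow>
     (\<forall>s\<ge>0. \<forall>t\<ge>0. Vector_Spaces.linear (*\<^sub>C) (*\<^sub>C) (blinfun_apply (T s t))) \<and>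
     T 0 0 = id_blinfun \<and>
     (\<forall>s\<ge>0. \<forall>s'\<ge>0. \<forall>t\<ge>0. \<forall>t'\<ge>0. T (s + s') (t + t') = T s t o\<^sub>L T s' t')"

definition two_parameter_C0_semigroup ::
    "(real \<Rightarrow> real \<Rightarrow> 'a::complex_normed_vector \<Rightarrow>\<^sub>L 'a) \<Rightarrow> bool" where
  "two_parameter_C0_semigroup T \<longleftrightarrow>
     two_parameter_semigroup T \<and>
     (\<forall>x. continuous_on ({0..} \<times> {0..}) (\<lambda>(s, t). blinfun_apply (T s t) x))"

definition contractive ::
    "(real \<Rightarrow> real \<Rightarrow> 'a::complex_normed_vector \<Rightarrow>\<^sub>L 'a) \<Rightarrow> bool" where
  "contractive T \<longleftrightarrow> (\<forall>s\<ge>0. \<forall>t\<ge>0. norm (T s t) \<le> 1)"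

definition generator1 ::
    "(real \<Rightarrow> 'a::complex_normed_vector \<Rightarrow>\<^sub>L 'a) \<Rightarrow> 'a \<rightharpoonup> 'a" where
  "generator1 u x =
     (let q = (\<lambda>s. (blinfun_apply (u s) x - x) /\<^sub>R s)
      in if \<exists>y. (q \<longlongrightarrow> y) (at_right 0) then Some (Lim (at_right 0) q) else None)"

definition infinitesimal_generator ::
    "(real \<Rightarrow> real \<Rightarrow> 'a::complex_normed_vector \<Rightarrow>\<^sub>L 'a) \<Rightarrow> ('a \<rightharpoonup> 'a) \<times> ('a \<rightharpoonup> 'a)" where
  "infinitesimal_generator T = (generator1 (\<lambda>s. T s 0), generator1 (\<lambda>t. T 0 t))"

lemma generator1_eq_Some_iff:
  "generator1 u x = Some y \<longleftrightarrow> ((\<lambda>s. (blinfun_apply (u s) x - x) /\<^sub>R s) \<longlongrightarrow> y) (at_right 0)"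
  unfolding generator1_def Let_def
  by (auto simp: tendsto_Lim intro: tendsto_unique[OF trivial_limit_at_right_real])

end

theory Submission
  imports Defs
begin

text \<open>
  Both directions are the Lumer--Phillips theorem for one-parameter contraction semigroups, applied
  to each of the two operators; the second parameter enters only through commutation.

  From the semigroup to the operators: the inequality \<open>Re \<langle>A x, f\<rangle> \<le> 0\<close> for \<^emph>\<open>every\<close> \<open>f \<in> F(x)\<close>
  is the limit of \<open>Re \<langle>(u(s)x - x)/s, f\<rangle> \<le> 0\<close>, which only says \<open>\<parallel>u(s)\<parallel> \<le> 1\<close>. Dissipativity also
  needs \<open>F(x) \<noteq> {}\<close>, that is, the Hahn--Banach theorem; it is obtained here from minimal sublinear
  functionals (\<open>duality_set_nonempty\<close>). The range condition is usually read off from the Laplace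
  transform of the semigroup. Improper integrals are avoided by integrating \<open>e\<^sup>-\<^sup>l\<^sup>t u(t) z\<close> over
  \<open>[0, 1]\<close> only: \<open>l - A\<close> maps this integral to \<open>z - e\<^sup>-\<^sup>l u(1) z\<close>, and since \<open>e\<^sup>-\<^sup>l u(1)\<close> is a strict
  contraction every vector has that form (\<open>generator_range\<close>).

  From the operators to the semigroup: a dissipative \<open>A\<close> with \<open>l\<^sub>0 - A\<close> onto has contractive
  resolvents \<open>J(h) = (1 - h A)\<^sup>-\<^sup>1\<close> for all \<open>h > 0\<close>, and the semigroup is the limit of the Euler
  products \<open>J(t/2\<^sup>k)\<close> raised to the power \<open>2\<^sup>k\<close>. Everything rests on the single estimate
  \<open>\<parallel>J(a + b)x - J(a)J(b)x\<parallel> \<le> a b \<parallel>A\<^sup>2x\<parallel>\<close> (\<open>resolvent_two_steps\<close>). The \<open>n\<close>th powers of commuting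
  contractions \<open>P\<close>, \<open>Q\<close> satisfy \<open>\<parallel>P\<^sup>nx - Q\<^sup>nx\<parallel> \<le> n \<parallel>Px - Qx\<parallel>\<close>, so with \<open>n = 2\<^sup>k\<close> the estimate gives
  an error of order \<open>2\<^sup>-\<^sup>k\<close>: with \<open>a = b\<close> this is convergence, with general \<open>a\<close> and \<open>b\<close> it is the
  semigroup law, and the total error against \<open>J(t)\<close> is of order \<open>t\<^sup>2\<close>, so that the generator agrees
  with \<open>A\<close> on the dense domain of \<open>A\<^sup>2\<close>. Then the resolvents of \<open>A\<close> and of the generator agree on
  the dense set \<open>D(A)\<close>, hence everywhere, and the two operators are equal
  (\<open>generator_generated\<close>).

  Two parameters: \<open>A\<^sub>2\<close> is closed, densely defined and bounded, hence everywhere defined, so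
  \<open>A\<^sub>1A\<^sub>2 = A\<^sub>2A\<^sub>1\<close> says that the bounded operator \<open>A\<^sub>2\<close> maps \<open>D(A\<^sub>1)\<close> to itself and commutes with \<open>A\<^sub>1\<close>
  there. A bounded operator that commutes with a generator in this sense commutes with its semigroup
  (\<open>generated_intertwines\<close>). Used first for \<open>A\<^sub>2\<close> against \<open>A\<^sub>1\<close> and then for \<open>u(s)\<close> against \<open>A\<^sub>2\<close>,
  this shows that the two semigroups \<open>u\<close> and \<open>v\<close> commute, and \<open>T(s,t) = u(s)v(t)\<close> is as required.
\<close>

section \<open>Support functionals and the duality set\<close>

lemma clinear_iff:
  "Vector_Spaces.linear (*\<^sub>C) (*\<^sub>C) f \<longleftrightarrow> (\<forall>x y. f (x + y) = f x + f y) \<and> (\<forall>c x. f (c *\<^sub>C x) = c *\<^sub>C f x)"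
  for f :: "'a::complex_normed_vector \<Rightarrow> 'b::complex_normed_vector"
  by (metis (no_types, lifting) Vector_Spaces.linear_iff complex_vector.vector_space_axioms)

lemma scaleC_scaleR_commute: "c *\<^sub>C r *\<^sub>R x = r *\<^sub>R c *\<^sub>C x"
  for x :: "'a::complex_normed_vector"
  by (metis mult.commute scaleC_of_real scaleC_scaleC)

lemma bounded_linear_scaleC: "bounded_linear (\<lambda>x::'a::complex_normed_vector. c *\<^sub>C x)"
  by (rule bounded_linear_intro[where K = "cmod c"])
    (simp_all add: scaleC_add_right scaleC_scaleR_commute norm_scaleC mult.commute)

definition sublinear :: "('a::real_vector \<Rightarrow> real) \<Rightarrow> bool" where
  "sublinear p \<longleftrightarrow> (\<forall>x y. p (x + y) \<le> p x + p y) \<and> (\<forall>r\<ge>0. \<forall>x. p (r *\<^sub>R x) = r * p x)"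

lemma sublinear_zero: "sublinear p \<Longrightarrow> p 0 = 0"
  unfolding sublinear_def by (metis mult_zero_left order_refl scaleR_zero_left)

lemma sublinear_lower_bound:
  assumes p: "sublinear p"
  shows "- p (- x) \<le> p x"
proof -
  have "p (y + z) \<le> p y + p z" for y z using p by (auto simp: sublinear_def)
  from this[of x "- x"] show ?thesis using sublinear_zero[OF p] by simp
qed

text \<open>The functional \<open>q\<close> is \<open>p\<close> made as small as possible in the direction \<open>- a\<close>:
  \<open>q(y) = inf\<^sub>t (p(y + t a) - t p(a))\<close> over \<open>t \<ge> 0\<close>. The value \<open>t = 0\<close> gives \<open>q \<le> p\<close>, and \<open>t = 1\<close>
  gives the bound at \<open>- a\<close>. The lemma is used twice: a minimal sublinear functional must coincide
  with its own \<open>q\<close>, so it is odd, and when \<open>p\<close> is the norm, every linear functional below \<open>q\<close>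
  attains the norm at \<open>a\<close>.\<close>

lemma sublinear_direction:
  assumes p: "sublinear p"
  obtains q where "sublinear q" "q \<le> p" "q (- a) \<le> - p a"
proof
  define g where "g y t = p (y + t *\<^sub>R a) - t * p a" for y t
  define q where "q y = (INF t\<in>{0..}. g y t)" for y
  have add: "p (x + y) \<le> p x + p y" for x y using p by (auto simp: sublinear_def)
  have scale: "p (r *\<^sub>R x) = r * p x" if "r \<ge> 0" for r x using p that by (auto simp: sublinear_def)
  have lower: "- p (- y) \<le> g y t" if "t \<ge> 0" for y t
    using add[of "y + t *\<^sub>R a" "- y"] scale[of t a] that by (simp add: g_def)
  have bdd: "bdd_below (g y ` {0..})" for y
    using lower by (auto simp: bdd_below_def)
  have le: "q y \<le> g y t" if "t \<ge> 0" for y t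
    unfolding q_def using that by (intro cINF_lower[OF bdd]) auto
  have ge: "c \<le> q y" if "\<And>t. t \<ge> 0 \<Longrightarrow> c \<le> g y t" for y c
    unfolding q_def using that by (intro cINF_greatest) auto
  have q0: "q 0 = 0"
  proof (rule antisym)
    show "q 0 \<le> 0" using le[of 0 0] sublinear_zero[OF p] by (simp add: g_def)
    show "0 \<le> q 0" by (rule ge) (simp add: g_def scale)
  qed
  have sub: "q (x + y) \<le> q x + q y" for x y
  proof -
    have 1: "q (x + y) \<le> g x s + g y t" if "s \<ge> 0" "t \<ge> 0" for s t
      using le[of "s + t" "x + y"] that add[of "x + s *\<^sub>R a" "y + t *\<^sub>R a"]
      by (simp add: g_def algebra_simps)
    have "q (x + y) - g x s \<le> q y" if "s \<ge> 0" for s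
      by (rule ge) (use 1 that in \<open>simp add: algebra_simps\<close>)
    then have "q (x + y) - q y \<le> q x"
      by (intro ge) (simp add: algebra_simps)
    then show ?thesis by simp
  qed
  have hom_le: "q (r *\<^sub>R x) \<le> r * q x" if r: "r > 0" for r x
  proof -
    have "q (r *\<^sub>R x) / r \<le> g x t" if t: "t \<ge> 0" for t
      using le[of "r * t" "r *\<^sub>R x"] r t scale[of r "x + t *\<^sub>R a"]
      by (simp add: g_def field_simps scaleR_add_right)
    then have "q (r *\<^sub>R x) / r \<le> q x" by (rule ge)
    then show ?thesis using r by (simp add: field_simps)
  qed
  have hom: "q (r *\<^sub>R x) = r * q x" if "r \<ge> 0" for r x
  proof (cases "r = 0")
    case False
    then have r: "r > 0" using that by simp
    have "q x \<le> inverse r * q (r *\<^sub>R x)"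
      using hom_le[of "inverse r" "r *\<^sub>R x"] r by simp
    then have "r * q x \<le> q (r *\<^sub>R x)" using r by (simp add: field_simps)
    then show ?thesis using hom_le[OF r, of x] by simp
  qed (simp add: q0)
  show "sublinear q" using sub hom by (auto simp: sublinear_def)
  show "q \<le> p" using le[of 0] by (auto simp: le_fun_def g_def)
  show "q (- a) \<le> - p a" using le[of 1 "- a"] sublinear_zero[OF p] by (simp add: g_def)
qed

text \<open>Hahn--Banach without extending partial functionals: among the sublinear functionals
  below \<open>p\<close> there is a minimal one by Zorn's lemma, since infima of chains stay sublinear and are
  bounded below by \<open>- p(- x)\<close>. By \<open>sublinear_direction\<close> a minimal one is odd, hence linear.\<close>

lemma linear_below_sublinear:
  assumes p: "sublinear p"
  obtains q where "linear q" "q \<le> p"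
proof -
  let ?S = "{q. sublinear q \<and> q \<le> p}"
  let ?r = "relation_of (\<lambda>f g. g \<le> f) ?S"
  have "\<exists>m\<in>?S. \<forall>a\<in>?S. a \<le> m \<longrightarrow> a = m"
  proof (rule predicate_Zorn)
    show "partial_order_on ?S ?r"
      by (rule partial_order_on_relation_ofI) auto
  next
    fix C assume C: "C \<in> Chains ?r"
    have CS: "q \<in> ?S" if "q \<in> C" for q using C that by (auto simp: Chains_def relation_of_def)
    have tot: "q \<le> q' \<or> q' \<le> q" if "q \<in> C" "q' \<in> C" for q q'
      using C that by (auto simp: Chains_def relation_of_def)
    show "\<exists>u\<in>?S. \<forall>a\<in>C. u \<le> a"
    proof (cases "C = {}")
      case True then show ?thesis using p by auto
    next
      case False
      then obtain q0 where q0: "q0 \<in> C" by auto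
      define u where "u x = (INF q\<in>C. q x)" for x
      have lower: "- p (- x) \<le> q x" if "q \<in> C" for q x
        using sublinear_lower_bound[of q x] CS[OF that] le_funD[of q p "- x"] by auto
      have bdd: "bdd_below ((\<lambda>q. q x) ` C)" for x
        using lower by (auto simp: bdd_below_def)
      have le: "u x \<le> q x" if "q \<in> C" for q x
        unfolding u_def by (rule cINF_lower[OF bdd that])
      have ge: "c \<le> u x" if "\<And>q. q \<in> C \<Longrightarrow> c \<le> q x" for x c
        unfolding u_def using that False by (intro cINF_greatest) auto
      have sub: "u (x + y) \<le> u x + u y" for x y
      proof -
        have 1: "u (x + y) \<le> q x + q' y" if qs: "q \<in> C" "q' \<in> C" for q q'
        proof -
          obtain m where m: "m \<in> C" "m \<le> q" "m \<le> q'" using tot[OF qs] qs by blast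
          have "m (x + y) \<le> m x + m y" using CS[OF m(1)] by (auto simp: sublinear_def)
          then show ?thesis using le[OF m(1), of "x + y"] le_funD[OF m(2), of x] le_funD[OF m(3), of y]
            by linarith
        qed
        have "u (x + y) - q x \<le> u y" if "q \<in> C" for q
          by (rule ge) (use 1[OF that] in \<open>simp add: diff_le_eq add.commute\<close>)
        then have "u (x + y) - u y \<le> u x"
          by (intro ge) (simp add: algebra_simps)
        then show ?thesis by simp
      qed
      have hom: "u (r *\<^sub>R x) = r * u x" if r: "r \<ge> 0" for r x
      proof -
        have eq: "q (r *\<^sub>R x) = r * q x" if "q \<in> C" for q
          using CS[OF that] r by (auto simp: sublinear_def)
        show ?thesis
        proof (cases "r = 0")
          case True
          have "q 0 = 0" if "q \<in> C" for q using eq[OF that] True by simp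
          then have "u 0 = 0" using le[OF q0, of 0] ge[of 0 0] q0 by (metis antisym order_refl)
          then show ?thesis using True by simp
        next
          case False
          then have r: "r > 0" using r by simp
          have "u (r *\<^sub>R x) / r \<le> u x"
            by (rule ge) (use le[of _ "r *\<^sub>R x"] eq r in \<open>auto simp: field_simps\<close>)
          moreover have "r * u x \<le> u (r *\<^sub>R x)"
            by (rule ge) (metis eq le less_imp_le mult_left_mono r)
          ultimately show ?thesis using r by (intro antisym) (auto simp: field_simps)
        qed
      qed
      have "u x \<le> p x" for x using le[OF q0, of x] CS[OF q0] by (auto simp: le_fun_def intro: order_trans)
      then have "u \<in> ?S" using sub hom by (auto simp: sublinear_def le_fun_def)
      then show ?thesis using le by (auto simp: le_fun_def)
    qed
  qed
  then obtain m where m: "sublinear m" "m \<le> p" and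
    min: "\<And>a. sublinear a \<Longrightarrow> a \<le> m \<Longrightarrow> a = m"
    by (auto intro: order_trans)
  have neg: "m (- a) = - m a" for a
  proof -
    obtain q where "sublinear q" "q \<le> m" "q (- a) \<le> - m a"
      using sublinear_direction[OF m(1)] .
    then have "m (- a) \<le> - m a" using min by auto
    then show ?thesis using sublinear_lower_bound[OF m(1), of "-a"] by simp
  qed
  have sub: "m (x + y) \<le> m x + m y" for x y using m(1) by (auto simp: sublinear_def)
  have add: "m (x + y) = m x + m y" for x y
    using sub[of x y] sub[of "x + y" "- y"] neg[of y] by simp
  have scale: "m (r *\<^sub>R x) = r * m x" for r x
  proof (cases "r \<ge> 0")
    case False
    then have "m ((- r) *\<^sub>R x) = - r * m x" using m(1) unfolding sublinear_def by (meson linear neg_0_le_iff_le)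
    then show ?thesis using neg[of "r *\<^sub>R x"] by simp
  qed (use m in \<open>auto simp: sublinear_def\<close>)
  have "linear m" by (rule linearI) (auto simp: add scale)
  then show thesis using m(2) that by blast
qed

text \<open>A real functional \<open>q\<close> below the norm with \<open>q(x) = \<parallel>x\<parallel>\<close> is the real part of the complex
  functional \<open>f(y) = q(y) - i q(i y)\<close>. Rotating \<open>y\<close> so that \<open>f(y)\<close> becomes real shows
  \<open>|f(y)| \<le> \<parallel>y\<parallel>\<close>, and \<open>\<parallel>x\<parallel> f\<close> lies in \<open>F(x)\<close>.\<close>

lemma duality_set_nonempty: "duality_set (x::'a::complex_normed_vector) \<noteq> {}"
proof -
  have "sublinear (norm :: 'a \<Rightarrow> real)" by (auto simp: sublinear_def norm_triangle_ineq)
  then obtain p where p: "sublinear p" "p \<le> (norm :: 'a \<Rightarrow> real)" "p (- x) \<le> - norm x"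
    using sublinear_direction by blast
  obtain q where q: "linear q" "q \<le> p" using linear_below_sublinear[OF p(1)] .
  have q_le: "q y \<le> norm y" for y using q(2) p(2) by (meson le_funD order_trans)
  have qx: "q x \<ge> norm x" using le_funD[OF q(2), of "- x"] p(3) linear_neg[OF q(1), of x] by simp
  define f where "f y = Complex (q y) (- q (\<i> *\<^sub>C y))" for y
  have decomp: "c *\<^sub>C y = Re c *\<^sub>R y + Im c *\<^sub>R (\<i> *\<^sub>C y)" for c and y :: 'a
  proof -
    have "c *\<^sub>C y = (of_real (Re c) + of_real (Im c) * \<i>) *\<^sub>C y"
      by (simp add: complex_eq[of c, symmetric] mult.commute)
    then show ?thesis by (simp only: scaleC_add_left scaleC_of_real scaleC_scaleC[symmetric])
  qed
  have ii: "\<i> *\<^sub>C \<i> *\<^sub>C y = - y" for y :: 'a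
    using decomp[of "-1" y] by (simp add: scaleC_scaleC)
  have f_add: "f (y + z) = f y + f z" for y z
    by (simp add: f_def complex_eq_iff scaleC_add_right linear_add[OF q(1)])
  have f_scale: "f (c *\<^sub>C y) = c * f y" for c y
    by (subst decomp)
      (simp add: f_def complex_eq_iff scaleC_add_right linear_add[OF q(1)] linear_scale[OF q(1)]
        linear_neg[OF q(1)] linear_diff[OF q(1)] scaleC_scaleR_commute ii algebra_simps)
  have f_norm: "norm (f y) \<le> norm y" for y
  proof (cases "f y = 0")
    case False
    \<comment> \<open>the phase that rotates \<open>f y\<close> onto the positive real axis\<close>
    define c where "c = cnj (f y) / norm (f y)"
    have "norm c = 1" using False by (simp add: c_def norm_divide)
    have "of_real (norm (f y)) = c * f y"
      using False by (simp add: c_def mult.commute[of "cnj _"] complex_norm_square[symmetric] power2_eq_square)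
    also have "\<dots> = f (c *\<^sub>C y)" by (simp add: f_scale)
    finally have "norm (f y) = q (c *\<^sub>C y)" by (simp add: f_def complex_eq_iff)
    also have "\<dots> \<le> norm y" using q_le[of "c *\<^sub>C y"] \<open>norm c = 1\<close> by (simp add: norm_scaleC)
    finally show ?thesis .
  qed simp
  have f_x: "f x = norm x"
  proof -
    have re: "Re (f x) = norm x" using qx q_le[of x] by (simp add: f_def)
    then have "(Im (f x))\<^sup>2 \<le> 0"
      using f_norm[of x] power_mono[OF f_norm[of x], of 2] by (simp add: cmod_power2)
    then show ?thesis using re by (simp add: complex_eq_iff)
  qed
  define g where "g y = norm x * f y" for y
  have scaleR: "r *\<^sub>R y = of_real r *\<^sub>C y" for r and y :: 'a by (simp add: scaleC_of_real)
  have bl: "bounded_linear g"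
    by (rule bounded_linear_intro[where K = "norm x"])
      (use f_norm in \<open>auto simp: g_def f_add f_scale scaleR distrib_left norm_mult scaleR_conv_of_real
        mult.commute[of _ "norm x"] intro: mult_left_mono\<close>)
  have norm_g: "norm (Blinfun g) = norm x"
  proof (rule antisym)
    show "norm (Blinfun g) \<le> norm x"
      by (rule norm_blinfun_bound)
        (use f_norm in \<open>auto simp: bounded_linear_Blinfun_apply[OF bl] g_def norm_mult intro: mult_left_mono\<close>)
    have "norm x * norm x \<le> norm (Blinfun g) * norm x"
      using norm_blinfun[of "Blinfun g" x]
      by (simp add: bounded_linear_Blinfun_apply[OF bl] g_def f_x norm_mult)
    then show "norm x \<le> norm (Blinfun g)" by (cases "x = 0") auto
  qed
  have "Blinfun g \<in> duality_set x"
    by (auto simp: duality_set_def bounded_linear_Blinfun_apply[OF bl] norm_g clinear_iff)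
      (auto simp: g_def f_x f_add f_scale power2_eq_square scaleC_complex_def algebra_simps)
  then show ?thesis by blast
qed

section \<open>Dissipative operators and their resolvents\<close>

lemma linear_operator_scaleR:
  assumes "linear_operator A" "x \<in> dom A"
  shows "r *\<^sub>R x \<in> dom A" "the (A (r *\<^sub>R x)) = r *\<^sub>R the (A x)"
  using assms unfolding linear_operator_def scaleC_of_real[symmetric]
  by (simp_all add: complex_vector.subspace_scale)

lemma linear_operator_scaleC:
  assumes "linear_operator A" "x \<in> dom A"
  shows "c *\<^sub>C x \<in> dom A" "the (A (c *\<^sub>C x)) = c *\<^sub>C the (A x)"
  using assms unfolding linear_operator_def
  by (simp_all add: complex_vector.subspace_scale)

lemma linear_operator_add:
  assumes "linear_operator A" "x \<in> dom A" "y \<in> dom A"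
  shows "x + y \<in> dom A" "the (A (x + y)) = the (A x) + the (A y)"
  using assms unfolding linear_operator_def
  by (simp_all add: complex_vector.subspace_add)

lemma linear_operator_diff:
  assumes "linear_operator A" "x \<in> dom A" "y \<in> dom A"
  shows "x - y \<in> dom A" "the (A (x - y)) = the (A x) - the (A y)"
  using linear_operator_add[OF assms(1,2), of "(-1) *\<^sub>R y"] linear_operator_scaleR[OF assms(1,3), of "-1"]
  by auto

text \<open>Test \<open>l x - A x\<close> against some \<open>f \<in> F(x)\<close>: the real part is at least \<open>l \<parallel>x\<parallel>\<^sup>2\<close> and at most
  \<open>\<parallel>x\<parallel> \<parallel>l x - A x\<parallel>\<close>.\<close>

lemma dissipative_lower_bound:
  assumes "dissipative A" "x \<in> dom A"
  shows "l * norm x \<le> norm (l *\<^sub>R x - the (A x))"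
proof (cases "x = 0")
  case False
  obtain f where f: "f \<in> duality_set x" "Re (blinfun_apply f (the (A x))) \<le> 0"
    using assms unfolding dissipative_def by blast
  have fx: "blinfun_apply f x = of_real ((norm x)\<^sup>2)" and nf: "norm f = norm x"
    using f(1) by (auto simp: duality_set_def)
  have "l * (norm x)\<^sup>2 \<le> Re (blinfun_apply f (l *\<^sub>R x - the (A x)))"
    using f(2) by (simp add: blinfun.diff_right blinfun.scaleR_right fx)
  also have "\<dots> \<le> norm x * norm (l *\<^sub>R x - the (A x))"
    using norm_blinfun[of f] complex_Re_le_cmod order_trans unfolding nf by blast
  finally show ?thesis using False by (simp add: power2_eq_square)
qed simp

text \<open>The equation \<open>l x - A x = y\<close> is the fixed point equation
  \<open>x = R(y + (l\<^sub>0 - l) x)\<close> for the inverse \<open>R\<close> of \<open>l\<^sub>0 - A\<close>. As \<open>R\<close> has Lipschitz constant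
  \<open>1/l\<^sub>0\<close>, Banach's theorem applies while \<open>|l\<^sub>0 - l| < l\<^sub>0\<close>.\<close>

lemma shifted_range_extend:
  fixes A :: "'a::complex_banach \<rightharpoonup> 'a"
  assumes A: "linear_operator A"
    and lower: "\<And>x. x \<in> dom A \<Longrightarrow> l\<^sub>0 * norm x \<le> norm (l\<^sub>0 *\<^sub>R x - the (A x))"
    and range: "shifted_range l\<^sub>0 A = UNIV"
    and l: "0 < l" "l < 2 * l\<^sub>0"
  shows "shifted_range l A = UNIV"
proof -
  have l0: "l\<^sub>0 > 0" using l by simp
  have "\<exists>x. x \<in> dom A \<and> l\<^sub>0 *\<^sub>R x - the (A x) = w" for w
  proof -
    have "w \<in> shifted_range l\<^sub>0 A" by (simp add: range)
    then show ?thesis unfolding shifted_range_def by blast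
  qed
  then obtain R where "\<And>w. R w \<in> dom A \<and> l\<^sub>0 *\<^sub>R R w - the (A (R w)) = w" by metis
  then have R: "\<And>w. R w \<in> dom A" "\<And>w. l\<^sub>0 *\<^sub>R R w - the (A (R w)) = w" by blast+
  have R_lip: "l\<^sub>0 * norm (R w - R w') \<le> norm (w - w')" for w w'
  proof -
    have "w - w' = l\<^sub>0 *\<^sub>R (R w - R w') - the (A (R w - R w'))"
      using R(2)[of w] R(2)[of w'] by (simp add: linear_operator_diff[OF A R(1) R(1)] algebra_simps)
    then show ?thesis using lower[OF linear_operator_diff(1)[OF A R(1) R(1)]] by metis
  qed
  have "y \<in> shifted_range l A" for y
  proof -
    have "\<exists>!x. R (y + (l\<^sub>0 - l) *\<^sub>R x) = x"
    proof (rule banach_fix_type)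
      show "0 \<le> \<bar>l\<^sub>0 - l\<bar> / l\<^sub>0" "\<bar>l\<^sub>0 - l\<bar> / l\<^sub>0 < 1" using l l0 by auto
      show "\<forall>x x'. dist (R (y + (l\<^sub>0 - l) *\<^sub>R x)) (R (y + (l\<^sub>0 - l) *\<^sub>R x'))
              \<le> \<bar>l\<^sub>0 - l\<bar> / l\<^sub>0 * dist x x'"
      proof (intro allI)
        fix x x'
        have "l\<^sub>0 * norm (R (y + (l\<^sub>0 - l) *\<^sub>R x) - R (y + (l\<^sub>0 - l) *\<^sub>R x'))
                \<le> norm ((l\<^sub>0 - l) *\<^sub>R (x - x'))"
          by (rule order_trans[OF R_lip]) (simp add: algebra_simps)
        then show "dist (R (y + (l\<^sub>0 - l) *\<^sub>R x)) (R (y + (l\<^sub>0 - l) *\<^sub>R x'))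
              \<le> \<bar>l\<^sub>0 - l\<bar> / l\<^sub>0 * dist x x'"
          using l0 by (simp only: dist_norm norm_scaleR) (simp add: pos_le_divide_eq mult.commute)
      qed
    qed
    then obtain x where x: "R (y + (l\<^sub>0 - l) *\<^sub>R x) = x" by blast
    have "x \<in> dom A" using R(1)[of "y + (l\<^sub>0 - l) *\<^sub>R x"] x by simp
    moreover have "y = l *\<^sub>R x - the (A x)"
      using R(2)[of "y + (l\<^sub>0 - l) *\<^sub>R x"] x by (simp add: algebra_simps)
    ultimately show ?thesis unfolding shifted_range_def by blast
  qed
  then show ?thesis by blast
qed

text \<open>From \<open>l\<^sub>0\<close> the previous lemma reaches everything below \<open>2 l\<^sub>0\<close>; repeated steps by a
  factor \<open>3/2\<close> exhaust the half-line.\<close>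

lemma dissipative_shifted_range:
  fixes A :: "'a::complex_banach \<rightharpoonup> 'a"
  assumes A: "linear_operator A" "dissipative A"
    and range: "shifted_range l\<^sub>0 A = UNIV" "l\<^sub>0 > 0"
    and l: "l > 0"
  shows "shifted_range l A = UNIV"
proof -
  have pos: "0 < (3/2)^n * l\<^sub>0" for n :: nat using range(2) by simp
  have n: "shifted_range ((3/2)^n * l\<^sub>0) A = UNIV" for n :: nat
  proof (induction n)
    case (Suc n)
    show ?case
      by (rule shifted_range_extend[OF A(1) dissipative_lower_bound[OF A(2)] Suc.IH])
        (use range(2) in auto)
  qed (use range in simp)
  obtain n :: nat where "l / l\<^sub>0 < (3/2)^n" using real_arch_pow[of "3/2" "l / l\<^sub>0"] by auto
  then have "l < (3/2)^n * l\<^sub>0" using range(2) by (simp add: pos_divide_less_eq)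
  then have "l < 2 * ((3/2)^n * l\<^sub>0)" using pos[of n] by linarith
  then show ?thesis
    by (intro shifted_range_extend[OF A(1) dissipative_lower_bound[OF A(2)] n l])
qed

lemma dense_eqI:
  fixes f g :: "'a::topological_space \<Rightarrow> 'b::t2_space"
  assumes "closure D = UNIV" "continuous_on UNIV f" "continuous_on UNIV g" "\<And>x. x \<in> D \<Longrightarrow> f x = g x"
  shows "f x = g x"
proof -
  have "closed {x. f x = g x}" using assms by (intro closed_Collect_eq)
  then have "closure D \<subseteq> {x. f x = g x}" using assms by (intro closure_minimal) auto
  then show ?thesis using assms by auto
qed

text \<open>The conditions that characterise generators of contraction semigroups, except for the
  density of the domain, which joins them where the semigroup is constructed.\<close>

locale m_dissipative =
  fixes A :: "'a::complex_banach \<rightharpoonup> 'a"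
  assumes linear_op: "linear_operator A"
    and dissip: "dissipative A"
    and range: "l > 0 \<Longrightarrow> shifted_range l A = UNIV"
begin

text \<open>The operator \<open>(1 - h A)\<^sup>-\<^sup>1\<close>, that is \<open>l (l - A)\<^sup>-\<^sup>1\<close> with \<open>l = 1/h\<close>, one step of the implicit
  Euler scheme. The identity at \<open>h = 0\<close> is its strong limit for densely defined \<open>A\<close>, and lets the
  statements below include a vanishing step.\<close>

definition resolvent :: "real \<Rightarrow> 'a \<Rightarrow> 'a" where
  "resolvent h x = (if h = 0 then x else THE z. z \<in> dom A \<and> z - h *\<^sub>R the (A z) = x)"

lemma resolvent_zero [simp]: "resolvent 0 x = x"
  by (simp add: resolvent_def)

lemma norm_le_norm_minus_scaled:
  assumes "z \<in> dom A" "h \<ge> 0"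
  shows "norm z \<le> norm (z - h *\<^sub>R the (A z))"
proof (cases "h = 0")
  case False
  then have h: "h > 0" using assms by simp
  have "norm z = h * (1/h * norm z)" using h by simp
  also have "\<dots> \<le> h * norm ((1/h) *\<^sub>R z - the (A z))"
    using dissipative_lower_bound[OF dissip assms(1), of "1/h"] h by (intro mult_left_mono) auto
  also have "\<dots> = norm (h *\<^sub>R ((1/h) *\<^sub>R z - the (A z)))" using h by simp
  also have "h *\<^sub>R ((1/h) *\<^sub>R z - the (A z)) = z - h *\<^sub>R the (A z)"
    using h by (simp add: scaleR_diff_right)
  finally show ?thesis .
qed simp

lemma resolvent_ex1:
  assumes h: "h > 0"
  shows "\<exists>!z. z \<in> dom A \<and> z - h *\<^sub>R the (A z) = x"
proof (rule ex_ex1I)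
  have "(1/h) *\<^sub>R x \<in> shifted_range (1/h) A" using range[of "1/h"] h by simp
  then obtain z where z: "z \<in> dom A" "(1/h) *\<^sub>R x = (1/h) *\<^sub>R z - the (A z)"
    unfolding shifted_range_def by blast
  have "x = h *\<^sub>R ((1/h) *\<^sub>R x)" using h by simp
  also have "\<dots> = z - h *\<^sub>R the (A z)" using h unfolding z(2) by (simp add: scaleR_diff_right)
  finally show "\<exists>z. z \<in> dom A \<and> z - h *\<^sub>R the (A z) = x" using z(1) by blast
next
  fix z w assume "z \<in> dom A \<and> z - h *\<^sub>R the (A z) = x" "w \<in> dom A \<and> w - h *\<^sub>R the (A w) = x"
  then have "z - w \<in> dom A" "(z - w) - h *\<^sub>R the (A (z - w)) = 0"
    using linear_operator_diff[OF linear_op, of z w] by (auto simp: algebra_simps)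
  then show "z = w" using norm_le_norm_minus_scaled[of "z - w" h] h by simp
qed

lemma resolvent_in_dom: "h > 0 \<Longrightarrow> resolvent h x \<in> dom A"
  and resolvent_eq: "h > 0 \<Longrightarrow> resolvent h x - h *\<^sub>R the (A (resolvent h x)) = x"
  using theI'[OF resolvent_ex1[of h x]] by (auto simp: resolvent_def)

lemma resolvent_unique:
  assumes "z \<in> dom A" "z - h *\<^sub>R the (A z) = x" "h \<ge> 0"
  shows "resolvent h x = z"
proof (cases "h = 0")
  case False
  then have "\<exists>!z. z \<in> dom A \<and> z - h *\<^sub>R the (A z) = x" using assms(3) by (intro resolvent_ex1) simp
  then show ?thesis using resolvent_in_dom resolvent_eq assms False by (metis less_eq_real_def)
qed (use assms in simp)

lemma resolvent_norm_le: "h \<ge> 0 \<Longrightarrow> norm (resolvent h x) \<le> norm x"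
  using norm_le_norm_minus_scaled[of "resolvent h x" h] resolvent_eq[of h x] resolvent_in_dom[of h x]
  by (cases "h = 0") auto

lemma resolvent_intertwines:
  assumes C: "linear C" "\<And>x. x \<in> dom A \<Longrightarrow> C x \<in> dom A" "\<And>x. x \<in> dom A \<Longrightarrow> the (A (C x)) = C (the (A x))"
    and h: "h \<ge> 0"
  shows "C (resolvent h x) = resolvent h (C x)"
proof (cases "h = 0")
  case False
  then have h: "h > 0" using h by simp
  let ?z = "resolvent h x"
  have "C ?z - h *\<^sub>R the (A (C ?z)) = C (?z - h *\<^sub>R the (A ?z))"
    by (simp add: C resolvent_in_dom[OF h] linear_diff[OF C(1)] linear_scale[OF C(1)])
  then show ?thesis
    using C(2) resolvent_in_dom[OF h] h by (intro resolvent_unique[symmetric]) (auto simp: resolvent_eq)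
qed simp

lemma resolvent_add: "h \<ge> 0 \<Longrightarrow> resolvent h (x + y) = resolvent h x + resolvent h y"
  and resolvent_scaleC: "h \<ge> 0 \<Longrightarrow> resolvent h (c *\<^sub>C x) = c *\<^sub>C resolvent h x"
proof -
  assume "h \<ge> 0"
  then consider "h = 0" | "h > 0" by fastforce
  then show "resolvent h (x + y) = resolvent h x + resolvent h y"
  proof cases
    case 2
    note L = linear_operator_add[OF linear_op resolvent_in_dom[OF 2] resolvent_in_dom[OF 2]]
    have "resolvent h x + resolvent h y - h *\<^sub>R the (A (resolvent h x + resolvent h y))
        = (resolvent h x - h *\<^sub>R the (A (resolvent h x))) + (resolvent h y - h *\<^sub>R the (A (resolvent h y)))"
      by (simp add: L algebra_simps)
    then show ?thesis using L 2 by (intro resolvent_unique) (auto simp: resolvent_eq)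
  qed simp
  from \<open>h \<ge> 0\<close> consider "h = 0" | "h > 0" by fastforce
  then show "resolvent h (c *\<^sub>C x) = c *\<^sub>C resolvent h x"
  proof cases
    case 2
    note L = linear_operator_scaleC[OF linear_op resolvent_in_dom[OF 2]]
    have "c *\<^sub>C resolvent h x - h *\<^sub>R the (A (c *\<^sub>C resolvent h x))
        = c *\<^sub>C (resolvent h x - h *\<^sub>R the (A (resolvent h x)))"
      by (simp add: L scaleC_scaleR_commute[symmetric] complex_vector.scale_right_diff_distrib)
    then show ?thesis using L 2 by (intro resolvent_unique) (auto simp: resolvent_eq)
  qed simp
qed

lemma resolvent_linear: "h \<ge> 0 \<Longrightarrow> linear (resolvent h)"
  by (rule linearI) (auto simp: resolvent_add resolvent_scaleC scaleC_of_real[symmetric])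

lemma resolvent_continuous: "h \<ge> 0 \<Longrightarrow> continuous_on S (resolvent h)"
  by (rule linear_continuous_on, rule bounded_linear_intro[where K = 1])
    (simp_all add: linear_add[OF resolvent_linear] linear_scale[OF resolvent_linear] resolvent_norm_le)

text \<open>For \<open>z = J(h)x\<close> the equation \<open>h A z = z - x\<close> shows that \<open>A z\<close> lies in the domain when \<open>x\<close>
  does, so \<open>A\<close> may be applied to \<open>z - h A z = x\<close>.\<close>

lemma resolvent_maps_dom:
  assumes x: "x \<in> dom A" and h: "h \<ge> 0"
  shows "resolvent h x \<in> dom A" "the (A (resolvent h x)) = resolvent h (the (A x))"
proof -
  have "resolvent h x \<in> dom A \<and> the (A (resolvent h x)) = resolvent h (the (A x))"
  proof (cases "h = 0")
    case False
    then have h: "h > 0" using h by simp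
    let ?z = "resolvent h x"
    have z: "?z \<in> dom A" "h *\<^sub>R the (A ?z) = ?z - x"
      using resolvent_in_dom[OF h] resolvent_eq[OF h, of x] by (auto simp: algebra_simps)
    have Az: "the (A ?z) = (1/h) *\<^sub>R (?z - x)" using z(2)[symmetric] h by simp
    have d: "?z - x \<in> dom A" by (rule linear_operator_diff[OF linear_op z(1) x])
    have "the (A ?z) \<in> dom A" unfolding Az by (rule linear_operator_scaleR[OF linear_op d])
    moreover have "the (A ?z) - h *\<^sub>R the (A (the (A ?z))) = the (A x)"
      using h by (subst (2) Az) (simp add: linear_operator_scaleR[OF linear_op d] linear_operator_diff[OF linear_op z(1) x])
    ultimately have "resolvent h (the (A x)) = the (A ?z)" using h by (intro resolvent_unique) simp_all
    then show ?thesis using z(1) by simp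
  qed (simp add: x)
  then show "resolvent h x \<in> dom A" "the (A (resolvent h x)) = resolvent h (the (A x))" by auto
qed

lemma resolvent_commute: "a \<ge> 0 \<Longrightarrow> b \<ge> 0 \<Longrightarrow> resolvent a (resolvent b x) = resolvent b (resolvent a x)"
  by (rule resolvent_intertwines) (simp_all add: resolvent_linear resolvent_maps_dom)

text \<open>On the domain of \<open>A\<close> this is the rate at which \<open>J(h)x\<close> tends to \<open>x\<close>.\<close>

lemma resolvent_minus_self:
  assumes "x \<in> dom A" "h \<ge> 0"
  shows "resolvent h x - x = h *\<^sub>R resolvent h (the (A x))"
  using resolvent_maps_dom(2)[OF assms] resolvent_eq[of h x] assms(2)
  by (cases "h = 0") (auto simp: algebra_simps)

end

text \<open>An m-dissipative operator is determined by a single resolvent: \<open>A x = y\<close> holds exactly if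
  \<open>J(1)\<close> maps \<open>x - y\<close> to \<open>x\<close>.\<close>

lemma m_dissipative_extension:
  assumes A: "m_dissipative A" and B: "m_dissipative B"
    and eq: "\<And>x. m_dissipative.resolvent A 1 x = m_dissipative.resolvent B 1 x"
    and Ax: "A x = Some y"
  shows "B x = Some y"
proof -
  have x: "x \<in> dom A" "the (A x) = y" using Ax by auto
  have "m_dissipative.resolvent A 1 (x - y) = x"
    by (rule m_dissipative.resolvent_unique[OF A x(1)]) (simp_all add: x(2))
  then have *: "m_dissipative.resolvent B 1 (x - y) = x" by (simp only: eq)
  have "x \<in> dom B" "x - the (B x) = x - y"
    using m_dissipative.resolvent_in_dom[OF B, of 1 "x - y"] m_dissipative.resolvent_eq[OF B, of 1 "x - y"]
    unfolding * by simp_all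
  then show ?thesis by auto
qed

lemma m_dissipative_eqI:
  assumes A: "m_dissipative A" and B: "m_dissipative B"
    and eq: "\<And>x. m_dissipative.resolvent A 1 x = m_dissipative.resolvent B 1 x"
  shows "A = B"
proof
  fix x show "A x = B x"
    using m_dissipative_extension[OF A B eq, of x] m_dissipative_extension[OF B A eq[symmetric], of x]
    by (cases "A x"; cases "B x") auto
qed

section \<open>The generator of a contraction semigroup\<close>

lemma has_vector_derivative_right_quotient:
  fixes f :: "real \<Rightarrow> 'a::real_normed_vector"
  assumes "(f has_vector_derivative d) (at a within {a..b})" "a < b"
  shows "((\<lambda>s. (f (a + s) - f a) /\<^sub>R s) \<longlongrightarrow> d) (at_right 0)"
proof -
  have "((\<lambda>y. norm (f y - f a - (y - a) *\<^sub>R d) / norm (y - a)) \<longlongrightarrow> 0) (at_right a)"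
    using assms by (simp add: has_vector_derivative_def has_derivative_iff_norm at_within_Icc_at_right)
  then have "((\<lambda>s. norm (f (a + s) - f a - s *\<^sub>R d) / norm s) \<longlongrightarrow> 0) (at_right 0)"
    unfolding filterlim_at_right_to_0[of _ _ a] by (simp add: add.commute)
  moreover have "\<forall>\<^sub>F s in at_right 0. norm (f (a + s) - f a - s *\<^sub>R d) / norm s
      = norm ((f (a + s) - f a) /\<^sub>R s - d)"
  proof (rule eventually_at_right_less[of 0, THEN eventually_mono])
    fix s :: real assume s: "0 < s"
    have "(f (a + s) - f a) /\<^sub>R s - d = (f (a + s) - f a - s *\<^sub>R d) /\<^sub>R s"
      using s by (simp add: scaleR_diff_right)
    then show "norm (f (a + s) - f a - s *\<^sub>R d) / norm s = norm ((f (a + s) - f a) /\<^sub>R s - d)"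
      by (simp add: divide_inverse mult.commute)
  qed
  ultimately have "((\<lambda>s. norm ((f (a + s) - f a) /\<^sub>R s - d)) \<longlongrightarrow> 0) (at_right 0)"
    by (rule Lim_transform_eventually)
  then show ?thesis by (simp add: tendsto_norm_zero_iff LIM_zero_iff)
qed

locale contraction_semigroup =
  fixes u :: "real \<Rightarrow> 'a::complex_banach \<Rightarrow>\<^sub>L 'a"
  assumes clinear: "t \<ge> 0 \<Longrightarrow> Vector_Spaces.linear (*\<^sub>C) (*\<^sub>C) (blinfun_apply (u t))"
    and at_zero: "u 0 = id_blinfun"
    and add: "s \<ge> 0 \<Longrightarrow> t \<ge> 0 \<Longrightarrow> u (s + t) = u s o\<^sub>L u t"
    and contraction: "t \<ge> 0 \<Longrightarrow> norm (u t) \<le> 1"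
    and continuous: "continuous_on {0..} (\<lambda>t. blinfun_apply (u t) x)"
begin

lemma norm_apply_le: "t \<ge> 0 \<Longrightarrow> norm (blinfun_apply (u t) x) \<le> norm x"
  using norm_blinfun[of "u t" x] contraction[of t] mult_right_mono[of "norm (u t)" 1 "norm x"] by simp

lemma apply_scaleC: "t \<ge> 0 \<Longrightarrow> blinfun_apply (u t) (c *\<^sub>C x) = c *\<^sub>C blinfun_apply (u t) x"
  using clinear by (simp add: clinear_iff)

lemma generator_linear: "linear_operator (generator1 u)"
proof -
  have add: "generator1 u (x + y) = Some (a + b)"
    if "generator1 u x = Some a" "generator1 u y = Some b" for x y a b
  proof -
    have "((\<lambda>s. (blinfun_apply (u s) x - x) /\<^sub>R s + (blinfun_apply (u s) y - y) /\<^sub>R s) \<longlongrightarrow> a + b) (at_right 0)"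
      using that by (intro tendsto_add) (auto simp: generator1_eq_Some_iff)
    then show ?thesis
      by (simp add: generator1_eq_Some_iff blinfun.add_right algebra_simps)
  qed
  have scale: "generator1 u (c *\<^sub>C x) = Some (c *\<^sub>C a)" if "generator1 u x = Some a" for c x a
  proof -
    have "((\<lambda>s. c *\<^sub>C ((blinfun_apply (u s) x - x) /\<^sub>R s)) \<longlongrightarrow> c *\<^sub>C a) (at_right 0)"
      using that unfolding generator1_eq_Some_iff by (rule bounded_linear.tendsto[OF bounded_linear_scaleC])
    moreover have "\<forall>\<^sub>F s in at_right 0. c *\<^sub>C ((blinfun_apply (u s) x - x) /\<^sub>R s)
        = (blinfun_apply (u s) (c *\<^sub>C x) - c *\<^sub>C x) /\<^sub>R s"
      by (rule eventually_at_right_less[of 0, THEN eventually_mono])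
        (simp add: apply_scaleC scaleC_scaleR_commute complex_vector.scale_right_diff_distrib)
    ultimately show ?thesis
      unfolding generator1_eq_Some_iff by (rule Lim_transform_eventually)
  qed
  have zero: "generator1 u 0 = Some 0" by (simp add: generator1_eq_Some_iff)
  show ?thesis
    unfolding linear_operator_def complex_vector.subspace_def dom_def
    using zero by (auto simp: add scale)
qed

text \<open>The difference quotients already satisfy the inequality, because
  \<open>Re \<langle>u(s)x, f\<rangle> \<le> \<parallel>f\<parallel> \<parallel>u(s)x\<parallel> \<le> \<parallel>x\<parallel>\<^sup>2 = \<langle>x, f\<rangle>\<close>.\<close>

lemma generator_duality:
  assumes "generator1 u x = Some y" "f \<in> duality_set x"
  shows "Re (blinfun_apply f y) \<le> 0"
proof (rule tendsto_upperbound)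
  show "((\<lambda>s. Re (blinfun_apply f ((blinfun_apply (u s) x - x) /\<^sub>R s))) \<longlongrightarrow> Re (blinfun_apply f y)) (at_right 0)"
    using assms(1) by (intro tendsto_intros) (auto simp: generator1_eq_Some_iff)
  have fx: "blinfun_apply f x = of_real ((norm x)\<^sup>2)" and nf: "norm f = norm x"
    using assms(2) by (auto simp: duality_set_def)
  show "\<forall>\<^sub>F s in at_right 0. Re (blinfun_apply f ((blinfun_apply (u s) x - x) /\<^sub>R s)) \<le> 0"
  proof (rule eventually_at_right_less[of 0, THEN eventually_mono])
    fix s :: real assume s: "0 < s"
    have "Re (blinfun_apply f (blinfun_apply (u s) x)) \<le> norm f * norm (blinfun_apply (u s) x)"
      using complex_Re_le_cmod norm_blinfun order_trans by blast
    also have "\<dots> \<le> (norm x)\<^sup>2"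
      using norm_apply_le[of s x] s by (simp add: nf power2_eq_square mult_left_mono)
    finally show "Re (blinfun_apply f ((blinfun_apply (u s) x - x) /\<^sub>R s)) \<le> 0"
      using s by (simp add: blinfun.scaleR_right blinfun.diff_right fx mult_le_0_iff)
  qed
qed simp

lemma generator_dissipative: "dissipative (generator1 u)"
  unfolding dissipative_def
proof
  fix x assume "x \<in> dom (generator1 u)"
  then obtain y where y: "generator1 u x = Some y" by auto
  obtain f where "f \<in> duality_set x" using duality_set_nonempty by blast
  then show "\<exists>f\<in>duality_set x. Re (blinfun_apply f (the (generator1 u x))) \<le> 0"
    using generator_duality[OF y] y by auto
qed

text \<open>Since \<open>\<phi>(t) = e\<^sup>-\<^sup>l\<^sup>t u(t)z\<close> is an orbit of the rescaled semigroup, applying \<open>u(s)\<close> to its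
  integral over \<open>[0, 1]\<close> moves the interval to \<open>[s, 1 + s]\<close> and multiplies by \<open>e\<^sup>l\<^sup>s\<close>. The right
  derivative at \<open>s = 0\<close> then follows from the fundamental theorem of calculus.\<close>

lemma generator_of_integral:
  fixes z :: 'a and l :: real
  defines "\<phi> \<equiv> \<lambda>t. exp (- l * t) *\<^sub>R blinfun_apply (u t) z"
  shows "generator1 u (integral {0..1} \<phi>) = Some (l *\<^sub>R integral {0..1} \<phi> - (z - \<phi> 1))"
proof -
  define \<Phi> where "\<Phi> t = integral {0..t} \<phi>" for t
  \<comment> \<open>the orbit \<open>u(s)\<close> applied to the integral, in closed form\<close>
  define \<Psi> where "\<Psi> s = exp (l * s) *\<^sub>R (\<Phi> (1 + s) - \<Phi> s)" for s
  have cont: "continuous_on {0..b} \<phi>" for b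
    unfolding \<phi>_def
    by (intro continuous_intros continuous_on_subset[OF continuous]) auto
  have shift: "blinfun_apply (u s) (integral {0..1} \<phi>) = \<Psi> s" if s: "s \<ge> 0" for s
  proof -
    have "integral {0..1} (blinfun_apply (u s) \<circ> \<phi>) = integral {0..1} (\<lambda>t. exp (l * s) *\<^sub>R (\<phi> \<circ> (+) s) t)"
    proof (rule integral_cong)
      fix t :: real assume "t \<in> {0..1}"
      then have t: "u (s + t) = u s o\<^sub>L u t" using s by (simp add: add)
      have "exp (l * s) * exp (- l * (s + t)) = exp (- l * t)"
        unfolding exp_add[symmetric] by (simp add: distrib_left)
      then show "(blinfun_apply (u s) \<circ> \<phi>) t = exp (l * s) *\<^sub>R (\<phi> \<circ> (+) s) t"
        unfolding \<phi>_def o_def t blinfun.scaleR_right scaleR_scaleR blinfun_apply_blinfun_compose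
        by (simp only:)
    qed
    then have 1: "blinfun_apply (u s) (integral {0..1} \<phi>) = exp (l * s) *\<^sub>R integral {s..1 + s} \<phi>"
      unfolding integral_linear[OF integrable_continuous_real[OF cont] blinfun.bounded_linear_right]
        integral_cmul integral_shift_Icc_real add_0 .
    have "integral {0..s} \<phi> + integral {s..1 + s} \<phi> = integral {0..1 + s} \<phi>"
      by (rule Henstock_Kurzweil_Integration.integral_combine[OF _ _ integrable_continuous_real[OF cont]]) (use s in simp_all)
    then have 2: "integral {s..1 + s} \<phi> = \<Phi> (1 + s) - \<Phi> s"
      unfolding \<Phi>_def by (metis add_diff_cancel_left')
    show ?thesis unfolding 1 2 \<Psi>_def ..
  qed
  have \<Phi>: "(\<Phi> has_vector_derivative \<phi> t) (at t within {0..2})" if "t \<in> {0..2}" for t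
    unfolding \<Phi>_def by (rule integral_has_vector_derivative[OF cont that])
  have \<Phi>1: "((\<Phi> \<circ> (+) 1) has_vector_derivative 1 *\<^sub>R \<phi> 1) (at 0 within {0..1})"
  proof (rule vector_diff_chain_within)
    show "((+) 1 has_vector_derivative 1) (at 0 within {0..1::real})"
      by (auto intro!: derivative_eq_intros)
    show "(\<Phi> has_vector_derivative \<phi> 1) (at (1 + 0) within (+) 1 ` {0..1})"
      by (rule has_vector_derivative_within_subset[where S = "{0..2}"]) (use \<Phi>[of 1] in auto)
  qed
  have \<Phi>0: "(\<Phi> has_vector_derivative \<phi> 0) (at 0 within {0..1})"
    by (rule has_vector_derivative_within_subset[where S = "{0..2}"]) (use \<Phi>[of 0] in auto)
  have 1: "((\<lambda>s. exp (l * s)) has_real_derivative l) (at 0 within {0..1})"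
    by (auto intro!: derivative_eq_intros)
  have 2: "((\<lambda>s. \<Phi> (1 + s) - \<Phi> s) has_vector_derivative 1 *\<^sub>R \<phi> 1 - \<phi> 0) (at 0 within {0..1})"
    using has_vector_derivative_diff[OF \<Phi>1 \<Phi>0] by (simp add: o_def)
  have "(\<Psi> has_vector_derivative l *\<^sub>R integral {0..1} \<phi> - (z - \<phi> 1)) (at 0 within {0..1})"
    using has_vector_derivative_scaleR[OF 1 2]
    by (simp add: \<Psi>_def[abs_def] \<Phi>_def \<phi>_def at_zero algebra_simps)
  then have lim: "((\<lambda>s. (\<Psi> (0 + s) - \<Psi> 0) /\<^sub>R s) \<longlongrightarrow> l *\<^sub>R integral {0..1} \<phi> - (z - \<phi> 1)) (at_right 0)"
    by (rule has_vector_derivative_right_quotient[where f = \<Psi> and a = 0 and b = 1]) simp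
  have \<Psi>0: "\<Psi> 0 = integral {0..1} \<phi>"
    using shift[of 0] by (simp only: at_zero id_blinfun.rep_eq id_apply order_refl)
  have "\<forall>\<^sub>F s in at_right (0::real). s > 0" by (rule eventually_at_right_less)
  then have ev: "\<forall>\<^sub>F s in at_right 0. (\<Psi> (0 + s) - \<Psi> 0) /\<^sub>R s
      = (blinfun_apply (u s) (integral {0..1} \<phi>) - integral {0..1} \<phi>) /\<^sub>R s"
    by (rule eventually_mono) (simp only: shift \<Psi>0 add_0 less_imp_le)
  show ?thesis
    unfolding generator1_eq_Some_iff by (rule Lim_transform_eventually[OF lim ev])
qed

text \<open>Given \<open>y\<close>, the Banach fixed point theorem provides \<open>z\<close> with \<open>z - e\<^sup>-\<^sup>l u(1)z = y\<close>; the
  integral of the rescaled orbit of \<open>z\<close> then solves \<open>l x - A x = y\<close>.\<close>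

lemma generator_range:
  assumes l: "l > 0"
  shows "shifted_range l (generator1 u) = UNIV"
proof -
  have "y \<in> shifted_range l (generator1 u)" for y
  proof -
    have "\<exists>!z. y + exp (- l) *\<^sub>R blinfun_apply (u 1) z = z"
    proof (rule banach_fix_type)
      show "0 \<le> exp (- l)" "exp (- l) < 1" using l by auto
      show "\<forall>z z'. dist (y + exp (- l) *\<^sub>R blinfun_apply (u 1) z) (y + exp (- l) *\<^sub>R blinfun_apply (u 1) z')
          \<le> exp (- l) * dist z z'"
        using norm_apply_le[of 1]
        by (simp add: dist_norm flip: scaleR_diff_right blinfun.diff_right)
    qed
    then obtain z where z: "y + exp (- l) *\<^sub>R blinfun_apply (u 1) z = z" by blast
    define x where "x = integral {0..1} (\<lambda>t. exp (- l * t) *\<^sub>R blinfun_apply (u t) z)"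
    have "z - exp (- l * 1) *\<^sub>R blinfun_apply (u 1) z = y" using z by (simp add: algebra_simps)
    then have "generator1 u x = Some (l *\<^sub>R x - y)"
      unfolding x_def generator_of_integral[of l z] by simp
    then have "x \<in> dom (generator1 u)" "y = l *\<^sub>R x - the (generator1 u x)" by auto
    then show ?thesis unfolding shifted_range_def by blast
  qed
  then show ?thesis by blast
qed

lemma generator_m_dissipative: "m_dissipative (generator1 u)"
  by unfold_locales (auto simp: generator_linear generator_dissipative generator_range)

end

section \<open>Euler products of resolvents\<close>

lemma linear_funpow: "linear f \<Longrightarrow> linear (f ^^ n)" for f :: "'a::real_vector \<Rightarrow> 'a"
proof (induction n)
  case 0
  show ?case by (simp only: funpow.simps linear_id)
next
  case (Suc n)
  then show ?case using linear_compose[of "f ^^ n" f] by (simp only: funpow.simps)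
qed

lemma norm_funpow_le:
  fixes f :: "'a::real_normed_vector \<Rightarrow> 'a"
  assumes "\<And>x. norm (f x) \<le> norm x"
  shows "norm ((f ^^ n) x) \<le> norm x"
proof (induction n)
  case (Suc n)
  show ?case using order_trans[OF assms Suc.IH] by simp
qed simp

lemma funpow_intertwines:
  assumes "\<And>x. C (f x) = f (C x)"
  shows "C ((f ^^ n) x) = (f ^^ n) (C x)"
  by (induction n) (simp_all add: assms)

lemma funpow_compose_commuting:
  assumes "\<And>x. f (g x) = g (f x)"
  shows "((\<lambda>x. f (g x)) ^^ n) x = (f ^^ n) ((g ^^ n) x)"
  by (induction n) (simp_all add: funpow_intertwines[of g f, OF assms[symmetric]])

text \<open>Telescoping: exchange the \<open>n\<close> factors one at a time. Since all factors commute and are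
  contractions, each exchange costs at most \<open>\<parallel>Px - Qx\<parallel>\<close> at the same point \<open>x\<close>.\<close>

lemma norm_funpow_diff_le:
  fixes P Q :: "'a::real_normed_vector \<Rightarrow> 'a"
  assumes lin: "linear P" "linear Q"
    and le: "\<And>x. norm (P x) \<le> norm x" "\<And>x. norm (Q x) \<le> norm x"
    and comm: "\<And>x. P (Q x) = Q (P x)"
  shows "norm ((P ^^ n) x - (Q ^^ n) x) \<le> real n * norm (P x - Q x)"
proof (induction n arbitrary: x)
  case (Suc n)
  have "(P ^^ Suc n) x - (Q ^^ Suc n) x = (P ^^ n) (P x - Q x) + ((P ^^ n) (Q x) - (Q ^^ n) (Q x))"
    by (simp add: funpow_Suc_right linear_diff[OF linear_funpow[OF lin(1)]] del: funpow.simps)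
  also have "norm \<dots> \<le> norm (P x - Q x) + real n * norm (P (Q x) - Q (Q x))"
    by (intro norm_triangle_mono norm_funpow_le le Suc.IH)
  also have "P (Q x) - Q (Q x) = Q (P x - Q x)"
    by (simp add: comm linear_diff[OF lin(2)])
  also have "norm (P x - Q x) + real n * norm (Q (P x - Q x)) \<le> norm (P x - Q x) + real n * norm (P x - Q x)"
    by (intro add_left_mono mult_left_mono le) simp
  finally show ?case by (simp add: algebra_simps)
qed simp

lemma convergent_on_dense:
  fixes L :: "nat \<Rightarrow> 'a::banach \<Rightarrow> 'a"
  assumes lin: "\<And>k. linear (L k)" and le: "\<And>k x. norm (L k x) \<le> norm x"
    and dense: "closure D = UNIV" and conv: "\<And>x. x \<in> D \<Longrightarrow> convergent (\<lambda>k. L k x)"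
  shows "convergent (\<lambda>k. L k x)"
proof -
  have "Cauchy (\<lambda>k. L k x)"
  proof (rule metric_CauchyI)
    fix e :: real assume e: "e > 0"
    have "x \<in> closure D" using dense by simp
    then obtain y where y: "y \<in> D" "dist y x < e / 3"
      unfolding closure_approachable using e by (meson divide_pos_pos zero_less_numeral)
    obtain M where M: "\<And>m n. m \<ge> M \<Longrightarrow> n \<ge> M \<Longrightarrow> dist (L m y) (L n y) < e / 3"
      using convergent_Cauchy[OF conv[OF y(1)]] e unfolding Cauchy_def by (meson divide_pos_pos zero_less_numeral)
    have close: "dist (L k x) (L k y) < e / 3" for k
      using le[of k "x - y"] y(2) by (simp add: dist_norm linear_diff[OF lin] norm_minus_commute)
    have "dist (L m x) (L n x) < e" if "m \<ge> M" "n \<ge> M" for m n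
    proof -
      have "dist (L m x) (L n x) \<le> dist (L m x) (L m y) + dist (L m y) (L n y) + dist (L n x) (L n y)"
        using dist_triangle[of "L m x" "L n x" "L m y"] dist_triangle[of "L m y" "L n x" "L n y"]
        by (simp add: dist_commute)
      also have "\<dots> < e" using close[of m] close[of n] M[OF that] by simp
      finally show ?thesis .
    qed
    then show "\<exists>M. \<forall>m\<ge>M. \<forall>n\<ge>M. dist (L m x) (L n x) < e" by blast
  qed
  then show ?thesis by (simp add: Cauchy_convergent_iff)
qed

text \<open>For these operators the limit of the Euler products is constructed below. Density enters
  through the domain of \<open>A\<^sup>2\<close>, where all error estimates take place.\<close>

locale densely_defined_m_dissipative = m_dissipative +
  assumes dense: "closure (dom A) = UNIV"
begin

definition dom_square :: "'a set" where
  "dom_square = {x \<in> dom A. the (A x) \<in> dom A}"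

definition square :: "'a \<Rightarrow> 'a" where
  "square x = the (A (the (A x)))"

text \<open>For \<open>x\<close> in the domain of \<open>A\<close>, the vectors \<open>J(h)x\<close> lie in the domain of \<open>A\<^sup>2\<close> and
  \<open>\<parallel>J(h)x - x\<parallel> \<le> h \<parallel>A x\<parallel>\<close>.\<close>

lemma dom_square_dense: "closure dom_square = UNIV"
proof -
  have "\<exists>z\<in>dom_square. dist z y < e" if e: "e > 0" for y e
  proof -
    have "y \<in> closure (dom A)" using dense by simp
    then obtain x where x: "x \<in> dom A" "dist x y < e / 2"
      unfolding closure_approachable using e by (meson half_gt_zero)
    define N where "N = norm (the (A x)) + 1"
    define h where "h = e / (2 * N)"
    have N: "N > 0" "norm (the (A x)) \<le> N" by (simp_all add: N_def add_nonneg_pos)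
    have h: "h > 0" using e N by (simp add: h_def)
    have "resolvent h x \<in> dom_square"
      using x(1) h by (simp add: dom_square_def resolvent_maps_dom resolvent_in_dom)
    moreover have "dist (resolvent h x) y < e"
    proof -
      have "dist (resolvent h x) x = h * norm (resolvent h (the (A x)))"
        using h resolvent_minus_self[OF x(1), of h] by (simp add: dist_norm)
      also have "\<dots> \<le> h * N"
        using h resolvent_norm_le[of h "the (A x)"] N(2) by (intro mult_left_mono) simp_all
      also have "\<dots> = e / 2" using N by (simp add: h_def)
      finally show ?thesis using x(2) dist_triangle[of "resolvent h x" y x] by simp
    qed
    ultimately show ?thesis by blast
  qed
  then show ?thesis by (auto simp: closure_approachable)
qed

lemma resolvent_expansion:
  assumes x: "x \<in> dom_square" and h: "h \<ge> 0"
  shows "resolvent h x = x + h *\<^sub>R the (A x) + h\<^sup>2 *\<^sub>R resolvent h (square x)"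
proof -
  have "the (A x) \<in> dom A" "x \<in> dom A" using x by (auto simp: dom_square_def)
  then have "resolvent h x = x + h *\<^sub>R resolvent h (the (A x))"
    "resolvent h (the (A x)) = the (A x) + h *\<^sub>R resolvent h (square x)"
    using resolvent_minus_self[of x h] resolvent_minus_self[of "the (A x)" h] h
    by (simp_all add: square_def diff_eq_eq add.commute)
  then show ?thesis by (simp add: scaleR_add_right power2_eq_square)
qed

text \<open>The resolvent is not a semigroup, but the defect is quadratic: as
  \<open>(1 - a A)(1 - b A) = 1 - (a + b)A + a b A\<^sup>2\<close>, one has
  \<open>J(a + b) - J(a)J(b) = a b J(a + b)J(a)J(b)A\<^sup>2\<close> on the domain of \<open>A\<^sup>2\<close>.\<close>

lemma resolvent_two_steps:
  assumes x: "x \<in> dom_square" and ab: "a \<ge> 0" "b \<ge> 0"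
  shows "norm (resolvent (a + b) x - resolvent a (resolvent b x)) \<le> a * b * norm (square x)"
proof (cases "a = 0 \<or> b = 0")
  case False
  then have pos: "a > 0" "b > 0" using ab by auto
  define C where "C y = resolvent a (resolvent b y)" for y
  have C: "C y \<in> dom A" "the (A (C y)) = C (the (A y))" if "y \<in> dom A" for y
    using that ab by (simp_all add: C_def resolvent_maps_dom)
  have xd: "x \<in> dom A" "the (A x) \<in> dom A" using x by (auto simp: dom_square_def)
  let ?w = "C x" and ?w1 = "C (the (A x))" and ?w2 = "C (square x)"
  have w: "?w \<in> dom A" "the (A ?w) = ?w1" "?w1 \<in> dom A" "the (A ?w1) = ?w2"
    using C xd by (simp_all add: square_def)
  have v: "resolvent b x = ?w - a *\<^sub>R ?w1"
    using resolvent_eq[OF pos(1), of "resolvent b x"] w(2) by (simp add: C_def)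
  have d: "a *\<^sub>R ?w1 \<in> dom A" "the (A (a *\<^sub>R ?w1)) = a *\<^sub>R ?w2"
    using linear_operator_scaleR[OF linear_op w(3), of a] w(4) by simp_all
  have "the (A (?w - a *\<^sub>R ?w1)) = ?w1 - a *\<^sub>R ?w2"
    using linear_operator_diff(2)[OF linear_op w(1) d(1)] w(2) d(2) by simp
  then have "x = (?w - a *\<^sub>R ?w1) - b *\<^sub>R (?w1 - a *\<^sub>R ?w2)"
    using resolvent_eq[OF pos(2), of x] v by simp
  then have "?w - (a + b) *\<^sub>R the (A ?w) = x - (a * b) *\<^sub>R ?w2"
    using w(2) by (simp add: algebra_simps)
  then have "?w = resolvent (a + b) (x - (a * b) *\<^sub>R ?w2)"
    using w(1) ab resolvent_unique[of ?w "a + b"] by simp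
  then have "resolvent (a + b) x - ?w = (a * b) *\<^sub>R resolvent (a + b) ?w2"
    using ab by (simp add: linear_diff[OF resolvent_linear] linear_scale[OF resolvent_linear])
  moreover have "norm (resolvent (a + b) ?w2) \<le> norm (square x)"
    unfolding C_def using ab by (intro order_trans[OF resolvent_norm_le]) (auto intro: resolvent_norm_le)
  ultimately show ?thesis using ab by (simp add: C_def mult_left_mono)
qed (use ab in \<open>auto simp: resolvent_def\<close>)

text \<open>Step sizes are halved rather than divided by a general \<open>n\<close>: then consecutive
  approximations compare one step of size \<open>h\<close> with two steps of size \<open>h/2\<close>, which is a case of
  \<open>resolvent_two_steps\<close>.\<close>

definition euler :: "nat \<Rightarrow> real \<Rightarrow> 'a \<Rightarrow> 'a" where
  "euler k t = resolvent (t / 2 ^ k) ^^ (2 ^ k)"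

lemma euler_linear: "t \<ge> 0 \<Longrightarrow> linear (euler k t)"
  unfolding euler_def by (intro linear_funpow resolvent_linear) simp

lemma euler_norm_le: "t \<ge> 0 \<Longrightarrow> norm (euler k t x) \<le> norm x"
  unfolding euler_def by (intro norm_funpow_le resolvent_norm_le) simp

lemma euler_zero [simp]: "euler k 0 x = x"
  using funpow_intertwines[of "\<lambda>_. x" "resolvent 0" "2 ^ k" x] by (simp add: euler_def)

lemma euler_intertwines:
  assumes "linear C" "\<And>x. x \<in> dom A \<Longrightarrow> C x \<in> dom A" "\<And>x. x \<in> dom A \<Longrightarrow> the (A (C x)) = C (the (A x))"
    and "t \<ge> 0"
  shows "C (euler k t x) = euler k t (C x)"
  unfolding euler_def using assms by (intro funpow_intertwines resolvent_intertwines) auto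

lemma euler_scaleC: "t \<ge> 0 \<Longrightarrow> euler k t (c *\<^sub>C x) = c *\<^sub>C euler k t x"
  unfolding euler_def by (rule funpow_intertwines[symmetric]) (simp add: resolvent_scaleC)

text \<open>Compare the powers of \<open>P = J(a + b)\<close> and \<open>Q = J(a)J(b)\<close> for \<open>a = s/2\<^sup>k\<close>, \<open>b = t/2\<^sup>k\<close>: there
  are \<open>2\<^sup>k\<close> factors, each contributing \<open>a b \<parallel>A\<^sup>2x\<parallel>\<close>.\<close>

lemma euler_add_estimate:
  assumes x: "x \<in> dom_square" and st: "s \<ge> 0" "t \<ge> 0"
  shows "norm (euler k (s + t) x - euler k s (euler k t x)) \<le> s * t / 2 ^ k * norm (square x)"
proof -
  define a b where "a = s / 2 ^ k" and "b = t / 2 ^ k"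
  have ab: "a \<ge> 0" "b \<ge> 0" using st by (simp_all add: a_def b_def)
  let ?P = "resolvent (a + b)" and ?Q = "\<lambda>x. resolvent a (resolvent b x)"
  have 1: "euler k s (euler k t x) = (?Q ^^ (2 ^ k)) x"
    using ab by (simp add: euler_def a_def b_def funpow_compose_commuting resolvent_commute)
  have 2: "euler k (s + t) x = (?P ^^ (2 ^ k)) x"
    by (simp add: euler_def a_def b_def add_divide_distrib)
  have "norm ((?P ^^ (2 ^ k)) x - (?Q ^^ (2 ^ k)) x) \<le> real (2 ^ k) * norm (?P x - ?Q x)"
  proof (rule norm_funpow_diff_le)
    show "linear ?Q" using linear_compose[of "resolvent b" "resolvent a"] ab by (simp add: resolvent_linear o_def)
    show "norm (?Q y) \<le> norm y" for y
      using resolvent_norm_le[of a "resolvent b y"] resolvent_norm_le[of b y] ab by simp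
  qed (use ab in \<open>simp_all add: resolvent_linear resolvent_norm_le resolvent_commute\<close>)
  also have "\<dots> \<le> real (2 ^ k) * (a * b * norm (square x))"
    using resolvent_two_steps[OF x ab] by (rule mult_left_mono) simp
  also have "\<dots> = (2 ^ k * a) * b * norm (square x)" by simp
  also have "\<dots> = s * t / 2 ^ k * norm (square x)" by (simp add: a_def b_def)
  finally show ?thesis by (simp only: 1 2)
qed

text \<open>Doubling the number of steps is the case \<open>s = t\<close> of the additivity estimate, because the
  \<open>(k+1)\<close>st approximation at time \<open>t\<close> is the square of the \<open>k\<close>th one at time \<open>t/2\<close>. The errors
  form a geometric series.\<close>

lemma euler_refine_estimate:
  assumes x: "x \<in> dom_square" and t: "t \<ge> 0"
  shows "norm (euler (k + m) t x - euler k t x) \<le> t\<^sup>2 / 2 * norm (square x) * (1 / 2 ^ k - 1 / 2 ^ (k + m))"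
proof (induction m)
  case (Suc m)
  define n where "n = k + m"
  have "norm (euler (Suc n) t x - euler n t x) \<le> t\<^sup>2 / 4 / 2 ^ n * norm (square x)"
  proof -
    define h where "h = t / 2 ^ Suc n"
    have "euler (Suc n) t x = (resolvent h ^^ (2 ^ n)) ((resolvent h ^^ (2 ^ n)) x)"
      by (simp only: euler_def h_def power_Suc mult_2 funpow_add o_apply)
    also have "\<dots> = euler n (t / 2) (euler n (t / 2) x)"
      by (simp only: euler_def h_def power_Suc divide_divide_eq_left)
    finally show ?thesis
      using euler_add_estimate[OF x, of "t / 2" "t / 2" n] t
      by (simp add: norm_minus_commute power2_eq_square)
  qed
  moreover have "t\<^sup>2 / 4 / 2 ^ n * norm (square x) = t\<^sup>2 / 2 * norm (square x) * (1 / 2 ^ n - 1 / 2 ^ Suc n)"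
    by (simp add: field_simps)
  ultimately have step: "norm (euler (Suc n) t x - euler n t x)
      \<le> t\<^sup>2 / 2 * norm (square x) * (1 / 2 ^ n - 1 / 2 ^ Suc n)" by simp
  have "norm (euler (Suc n) t x - euler k t x)
      \<le> norm (euler (Suc n) t x - euler n t x) + norm (euler n t x - euler k t x)"
    using norm_triangle_ineq[of "euler (Suc n) t x - euler n t x" "euler n t x - euler k t x"] by simp
  also have "\<dots> \<le> t\<^sup>2 / 2 * norm (square x) * (1 / 2 ^ n - 1 / 2 ^ Suc n)
      + t\<^sup>2 / 2 * norm (square x) * (1 / 2 ^ k - 1 / 2 ^ n)"
    using Suc.IH step unfolding n_def by (intro add_mono)
  also have "\<dots> = t\<^sup>2 / 2 * norm (square x) * (1 / 2 ^ k - 1 / 2 ^ Suc n)"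
    by (simp add: right_diff_distrib)
  finally show ?case by (simp add: n_def)
qed simp

lemma euler_convergent:
  assumes t: "t \<ge> 0"
  shows "convergent (\<lambda>k. euler k t x)"
proof (rule convergent_on_dense[OF euler_linear[OF t] euler_norm_le[OF t] dom_square_dense])
  fix x assume x: "x \<in> dom_square"
  define c where "c = t\<^sup>2 / 2 * norm (square x)"
  have c: "c \<ge> 0" by (simp add: c_def)
  have "Cauchy (\<lambda>k. euler k t x)"
  proof (rule CauchyI')
    fix e :: real assume e: "e > 0"
    have "(\<lambda>k. c * (1 / 2) ^ k) \<longlonglongrightarrow> c * 0"
      by (intro tendsto_intros LIMSEQ_power_zero) simp
    then have "\<forall>\<^sub>F k in sequentially. c * (1 / 2) ^ k < e"
      using e by (intro order_tendstoD(2)) simp_all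
    then obtain M where M: "\<And>k. k \<ge> M \<Longrightarrow> c * (1 / 2) ^ k < e"
      by (auto simp: eventually_sequentially)
    have "norm (euler m t x - euler n t x) < e" if "m \<ge> M" "n > m" for m n
    proof -
      obtain j where j: "n = m + j" using \<open>n > m\<close> less_imp_add_positive by blast
      have "norm (euler m t x - euler n t x) \<le> c * (1 / 2 ^ m - 1 / 2 ^ (m + j))"
        using euler_refine_estimate[OF x t, of m j] by (simp add: j c_def norm_minus_commute)
      also have "\<dots> \<le> c * (1 / 2) ^ m" using c by (intro mult_left_mono) (simp_all add: power_divide)
      also have "\<dots> < e" using M that by simp
      finally show ?thesis .
    qed
    then show "\<exists>M. \<forall>m\<ge>M. \<forall>n>m. dist (euler m t x) (euler n t x) < e"
      unfolding dist_norm by blast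
  qed
  then show "convergent (\<lambda>k. euler k t x)" by (simp add: Cauchy_convergent_iff)
qed

text \<open>Only times \<open>t \<ge> 0\<close> are meaningful, where the limit exists and is a bounded operator.\<close>

definition generated :: "real \<Rightarrow> 'a \<Rightarrow>\<^sub>L 'a" where
  "generated t = Blinfun (\<lambda>x. lim (\<lambda>k. euler k t x))"

lemma generated_limit_and_bound:
  assumes t: "t \<ge> 0"
  shows "(\<lambda>k. euler k t x) \<longlonglongrightarrow> blinfun_apply (generated t) x"
    and "norm (blinfun_apply (generated t) x) \<le> norm x"
proof -
  let ?S = "\<lambda>x. lim (\<lambda>k. euler k t x)"
  have lim: "(\<lambda>k. euler k t x) \<longlonglongrightarrow> ?S x" for x
    using euler_convergent[OF t] by (simp add: convergent_LIMSEQ_iff)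
  have le: "norm (?S x) \<le> norm x" for x
    by (rule tendsto_upperbound[OF tendsto_norm[OF lim]]) (auto simp: euler_norm_le[OF t])
  have "bounded_linear ?S"
  proof (rule bounded_linear_intro[where K = 1])
    fix x y r
    have "(\<lambda>k. euler k t (x + y)) \<longlonglongrightarrow> ?S x + ?S y"
      using tendsto_add[OF lim lim] by (simp add: linear_add[OF euler_linear[OF t]])
    then show "?S (x + y) = ?S x + ?S y" by (rule limI)
    have "(\<lambda>k. euler k t (r *\<^sub>R x)) \<longlonglongrightarrow> r *\<^sub>R ?S x"
      using tendsto_scaleR[OF tendsto_const lim] by (simp add: linear_scale[OF euler_linear[OF t]])
    then show "?S (r *\<^sub>R x) = r *\<^sub>R ?S x" by (rule limI)
  qed (simp add: le)
  then show "(\<lambda>k. euler k t x) \<longlonglongrightarrow> blinfun_apply (generated t) x"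
    "norm (blinfun_apply (generated t) x) \<le> norm x"
    using lim le by (simp_all add: generated_def bounded_linear_Blinfun_apply)
qed

lemmas generated_lim = generated_limit_and_bound(1)
  and generated_norm_le = generated_limit_and_bound(2)

text \<open>A bounded operator that commutes with \<open>A\<close> commutes with the resolvents, hence with their
  powers, hence with the limit.\<close>

lemma generated_intertwines:
  assumes C: "bounded_linear C" "\<And>x. x \<in> dom A \<Longrightarrow> C x \<in> dom A" "\<And>x. x \<in> dom A \<Longrightarrow> the (A (C x)) = C (the (A x))"
    and t: "t \<ge> 0"
  shows "C (blinfun_apply (generated t) x) = blinfun_apply (generated t) (C x)"
proof (rule LIMSEQ_unique)
  show "(\<lambda>k. C (euler k t x)) \<longlonglongrightarrow> C (blinfun_apply (generated t) x)"
    by (rule bounded_linear.tendsto[OF C(1) generated_lim[OF t]])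
  show "(\<lambda>k. C (euler k t x)) \<longlonglongrightarrow> blinfun_apply (generated t) (C x)"
    using generated_lim[OF t, of "C x"]
    by (simp add: euler_intertwines[OF bounded_linear.linear[OF C(1)] C(2,3) t])
qed

lemma generated_scaleC:
  assumes t: "t \<ge> 0"
  shows "blinfun_apply (generated t) (c *\<^sub>C x) = c *\<^sub>C blinfun_apply (generated t) x"
proof (rule LIMSEQ_unique)
  show "(\<lambda>k. c *\<^sub>C euler k t x) \<longlonglongrightarrow> c *\<^sub>C blinfun_apply (generated t) x"
    by (rule bounded_linear.tendsto[OF bounded_linear_scaleC generated_lim[OF t]])
  show "(\<lambda>k. c *\<^sub>C euler k t x) \<longlonglongrightarrow> blinfun_apply (generated t) (c *\<^sub>C x)"
    using generated_lim[OF t, of "c *\<^sub>C x"] by (simp add: euler_scaleC[OF t])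
qed

text \<open>On the domain of \<open>A\<^sup>2\<close> the defect of the \<open>k\<close>th approximation is at most
  \<open>s t 2\<^sup>-\<^sup>k \<parallel>A\<^sup>2x\<parallel>\<close>; both sides are bounded operators, so density does the rest.\<close>

lemma generated_add:
  assumes st: "s \<ge> 0" "t \<ge> 0"
  shows "generated (s + t) = generated s o\<^sub>L generated t"
proof (rule blinfun_eqI)
  let ?S = "\<lambda>t. blinfun_apply (generated t)"
  fix x
  have "?S (s + t) x = ?S s (?S t x)"
  proof (rule dense_eqI[OF dom_square_dense, where f = "?S (s + t)" and g = "\<lambda>x. ?S s (?S t x)"])
    fix x assume x: "x \<in> dom_square"
    have "(\<lambda>k. euler k (s + t) x - euler k s (euler k t x)) \<longlonglongrightarrow> 0"
    proof (rule Lim_null_comparison)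
      have "(\<lambda>k. s * t * norm (square x) * (1 / 2) ^ k) \<longlonglongrightarrow> s * t * norm (square x) * 0"
        by (rule tendsto_mult_left, rule LIMSEQ_power_zero) simp
      then show "(\<lambda>k. s * t * norm (square x) * (1 / 2) ^ k) \<longlonglongrightarrow> 0" by simp
      have "norm (euler k (s + t) x - euler k s (euler k t x)) \<le> s * t * norm (square x) * (1 / 2) ^ k" for k
        using euler_add_estimate[OF x st, of k] by (simp add: power_divide)
      then show "\<forall>\<^sub>F k in sequentially. norm (euler k (s + t) x - euler k s (euler k t x))
          \<le> s * t * norm (square x) * (1 / 2) ^ k" by (rule always_eventually[OF allI])
    qed
    moreover have "(\<lambda>k. euler k s (euler k t x) - euler k s (?S t x)) \<longlonglongrightarrow> 0"
    proof (rule Lim_null_comparison)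
      show "(\<lambda>k. norm (euler k t x - ?S t x)) \<longlonglongrightarrow> 0"
        using generated_lim[OF st(2)] by (simp add: tendsto_norm_zero_iff LIM_zero_iff)
      show "\<forall>\<^sub>F k in sequentially. norm (euler k s (euler k t x) - euler k s (?S t x))
          \<le> norm (euler k t x - ?S t x)"
        using euler_norm_le[OF st(1)] by (simp add: linear_diff[OF euler_linear[OF st(1)], symmetric])
    qed
    ultimately have "(\<lambda>k. (euler k (s + t) x - euler k s (euler k t x))
        + (euler k s (euler k t x) - euler k s (?S t x)) + euler k s (?S t x)) \<longlonglongrightarrow> 0 + 0 + ?S s (?S t x)"
      by (intro tendsto_add generated_lim st)
    then have "(\<lambda>k. euler k (s + t) x) \<longlonglongrightarrow> ?S s (?S t x)" by simp
    then show "?S (s + t) x = ?S s (?S t x)"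
      using generated_lim[of "s + t" x] st by (intro LIMSEQ_unique) simp_all
  qed (intro continuous_intros)+
  then show "?S (s + t) x = blinfun_apply (generated s o\<^sub>L generated t) x" by simp
qed

lemma generated_zero: "generated 0 = id_blinfun"
proof (rule blinfun_eqI)
  fix x
  have "(\<lambda>k. euler k 0 x) \<longlonglongrightarrow> x" by simp
  then show "blinfun_apply (generated 0) x = blinfun_apply id_blinfun x"
    using generated_lim[of 0 x] by (simp add: LIMSEQ_unique)
qed

text \<open>A second order Taylor bound, uniform in \<open>k\<close> before the limit: the Euler products differ
  from \<open>J(t)x\<close>, the case \<open>k = 0\<close>, by at most \<open>t\<^sup>2/2 \<parallel>A\<^sup>2x\<parallel>\<close>, and \<open>J(t)x\<close> differs from \<open>x + t A x\<close>
  by at most \<open>t\<^sup>2 \<parallel>A\<^sup>2x\<parallel>\<close>.\<close>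

lemma generated_expansion:
  assumes x: "x \<in> dom_square" and t: "t \<ge> 0"
  shows "norm (blinfun_apply (generated t) x - x - t *\<^sub>R the (A x)) \<le> 3 / 2 * t\<^sup>2 * norm (square x)"
proof -
  have "norm (blinfun_apply (generated t) x - resolvent t x) \<le> t\<^sup>2 / 2 * norm (square x)"
  proof (rule tendsto_upperbound)
    show "(\<lambda>k. norm (euler k t x - resolvent t x)) \<longlonglongrightarrow> norm (blinfun_apply (generated t) x - resolvent t x)"
      by (intro tendsto_intros generated_lim t)
    have "norm (euler k t x - resolvent t x) \<le> t\<^sup>2 / 2 * norm (square x)" for k
    proof -
      have "norm (euler k t x - resolvent t x) \<le> t\<^sup>2 / 2 * norm (square x) * (1 - 1 / 2 ^ k)"
        using euler_refine_estimate[OF x t, of 0 k] by (simp add: euler_def)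
      also have "\<dots> \<le> t\<^sup>2 / 2 * norm (square x) * 1" by (intro mult_left_mono) auto
      finally show ?thesis by simp
    qed
    then show "\<forall>\<^sub>F k in sequentially. norm (euler k t x - resolvent t x) \<le> t\<^sup>2 / 2 * norm (square x)"
      by simp
  qed simp
  moreover have "norm (resolvent t x - x - t *\<^sub>R the (A x)) \<le> t\<^sup>2 * norm (square x)"
    using resolvent_norm_le[OF t, of "square x"] by (simp add: resolvent_expansion[OF x t] mult_left_mono)
  moreover have "norm (blinfun_apply (generated t) x - x - t *\<^sub>R the (A x))
      \<le> norm (blinfun_apply (generated t) x - resolvent t x) + norm (resolvent t x - x - t *\<^sub>R the (A x))"
    by (rule order_trans[OF eq_refl norm_triangle_ineq]) (simp add: algebra_simps)
  ultimately show ?thesis by simp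
qed

lemma generated_continuous_at_zero:
  assumes e: "e > 0"
  shows "\<exists>d>0. \<forall>t. 0 \<le> t \<and> t < d \<longrightarrow> norm (blinfun_apply (generated t) x - x) < e"
proof -
  let ?S = "\<lambda>t. blinfun_apply (generated t)"
  have "x \<in> closure dom_square" using dom_square_dense by simp
  then obtain y where y: "y \<in> dom_square" "dist y x < e / 4"
    unfolding closure_approachable using e by (meson divide_pos_pos zero_less_numeral)
  define c where "c = norm (the (A y)) + 3 / 2 * norm (square y) + 1"
  have c: "c > 0" by (auto simp: c_def intro!: add_nonneg_pos)
  define d where "d = min 1 (e / (2 * c))"
  have d: "d > 0" using e c by (simp add: d_def)
  have "norm (?S t x - x) < e" if t: "0 \<le> t" "t < d" for t
  proof -
    have "norm (?S t y - y) \<le> norm (?S t y - y - t *\<^sub>R the (A y)) + norm (t *\<^sub>R the (A y))"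
      using norm_triangle_ineq[of "?S t y - y - t *\<^sub>R the (A y)" "t *\<^sub>R the (A y)"] by simp
    also have "\<dots> \<le> 3 / 2 * t\<^sup>2 * norm (square y) + t * norm (the (A y))"
      using generated_expansion[OF y(1) t(1)] t by simp
    also have "3 / 2 * t\<^sup>2 * norm (square y) \<le> t * (3 / 2 * norm (square y))"
      using mult_right_mono[of "t * t" "t * 1" "3 / 2 * norm (square y)"] t
      by (simp add: d_def power2_eq_square mult_left_le)
    also have "t * (3 / 2 * norm (square y)) + t * norm (the (A y)) \<le> t * c"
      using t by (simp add: c_def algebra_simps)
    also have "\<dots> \<le> e / 2" using t c by (simp add: d_def field_simps)
    finally have 1: "norm (?S t y - y) \<le> e / 2" by simp
    have 2: "norm (?S t (x - y)) \<le> norm (x - y)" by (rule generated_norm_le[OF t(1)])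
    have "?S t x - x = ?S t (x - y) + (?S t y - y) + (y - x)" by (simp add: blinfun.diff_right)
    then have eq: "norm (?S t x - x) = norm (?S t (x - y) + (?S t y - y) + (y - x))" by (rule arg_cong)
    have "norm (?S t x - x) \<le> norm (?S t (x - y)) + norm (?S t y - y) + norm (y - x)"
      using norm_triangle_ineq[of "?S t (x - y) + (?S t y - y)" "y - x"]
        norm_triangle_ineq[of "?S t (x - y)" "?S t y - y"] eq by linarith
    then show ?thesis using 1 2 y(2) by (simp add: dist_norm norm_minus_commute)
  qed
  then show ?thesis using d by blast
qed

text \<open>For contraction semigroups, \<open>\<parallel>u(t)x - u(s)x\<parallel> \<le> \<parallel>u(|t - s|)x - x\<parallel>\<close>, so continuity at \<open>0\<close>
  is enough.\<close>

lemma generated_continuous: "continuous_on {0..} (\<lambda>t. blinfun_apply (generated t) x)"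
  unfolding continuous_on_iff
proof (intro ballI allI impI)
  let ?S = "\<lambda>t. blinfun_apply (generated t)"
  fix s e :: real assume s: "s \<in> {0..}" and e: "e > 0"
  obtain d where d: "d > 0" "\<And>t. 0 \<le> t \<Longrightarrow> t < d \<Longrightarrow> norm (?S t x - x) < e"
    using generated_continuous_at_zero[OF e] by blast
  have le: "norm (?S b x - ?S a x) \<le> norm (?S (b - a) x - x)" if "0 \<le> a" "a \<le> b" for a b
  proof -
    have "?S b x = ?S a (?S (b - a) x)" using generated_add[of a "b - a"] that by simp
    then have "?S b x - ?S a x = ?S a (?S (b - a) x - x)" by (simp add: blinfun.diff_right)
    then show ?thesis using generated_norm_le[OF that(1)] by simp
  qed
  have "dist (?S t x) (?S s x) < e" if "t \<in> {0..}" "dist t s < d" for t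
  proof (cases "s \<le> t")
    case True
    then show ?thesis using le[of s t] d(2)[of "t - s"] that s by (simp add: dist_norm)
  next
    case False
    then show ?thesis using le[of t s] d(2)[of "s - t"] that s by (simp add: dist_norm norm_minus_commute)
  qed
  then show "\<exists>d>0. \<forall>t\<in>{0..}. dist t s < d \<longrightarrow> dist (?S t x) (?S s x) < e" using d(1) by blast
qed

lemma contraction_semigroup_generated: "contraction_semigroup generated"
proof (rule contraction_semigroup.intro)
  show "Vector_Spaces.linear (*\<^sub>C) (*\<^sub>C) (blinfun_apply (generated t))" if "t \<ge> 0" for t
    using that by (simp add: clinear_iff blinfun.add_right generated_scaleC)
  show "norm (generated t) \<le> 1" if "t \<ge> 0" for t
    by (rule norm_blinfun_bound) (simp_all add: generated_norm_le that)
qed (simp_all add: generated_zero generated_add generated_continuous)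

lemma generator_on_dom_square:
  assumes x: "x \<in> dom_square"
  shows "generator1 generated x = Some (the (A x))"
proof -
  let ?q = "\<lambda>t. (blinfun_apply (generated t) x - x) /\<^sub>R t"
  have "((\<lambda>t. ?q t - the (A x)) \<longlongrightarrow> 0) (at_right 0)"
  proof (rule Lim_null_comparison)
    have "((\<lambda>t. 3 / 2 * t * norm (square x)) \<longlongrightarrow> 3 / 2 * 0 * norm (square x)) (at_right 0)"
      by (intro tendsto_intros)
    then show "((\<lambda>t. 3 / 2 * t * norm (square x)) \<longlongrightarrow> 0) (at_right 0)" by simp
    have "\<forall>\<^sub>F t in at_right (0::real). t > 0" by (rule eventually_at_right_less)
    then show "\<forall>\<^sub>F t in at_right 0. norm (?q t - the (A x)) \<le> 3 / 2 * t * norm (square x)"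
    proof (rule eventually_mono)
      fix t :: real assume t: "t > 0"
      then have "?q t - the (A x) = (blinfun_apply (generated t) x - x - t *\<^sub>R the (A x)) /\<^sub>R t"
        by (simp add: scaleR_diff_right)
      then have "norm (?q t - the (A x)) = norm (blinfun_apply (generated t) x - x - t *\<^sub>R the (A x)) / t"
        using t by (simp add: divide_inverse_commute)
      also have "\<dots> \<le> 3 / 2 * t\<^sup>2 * norm (square x) / t"
        using generated_expansion[OF x, of t] t by (intro divide_right_mono) auto
      also have "\<dots> = 3 / 2 * t * norm (square x)" using t by (simp add: power2_eq_square)
      finally show "norm (?q t - the (A x)) \<le> 3 / 2 * t * norm (square x)" .
    qed
  qed
  then show ?thesis unfolding generator1_eq_Some_iff by (simp add: LIM_zero_iff)
qed

text \<open>Agreement on the domain of \<open>A\<^sup>2\<close> is enough to identify the generator \<open>G\<close>: for \<open>y\<close> in the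
  domain of \<open>A\<close> the vector \<open>x = J(1)y\<close> lies in the domain of \<open>A\<^sup>2\<close>, so \<open>x - G x = x - A x = y\<close>. Thus
  the two resolvents agree on a dense set, and by continuity everywhere.\<close>

lemma generator_generated: "generator1 generated = A"
proof (rule m_dissipative_eqI)
  interpret G: contraction_semigroup generated by (rule contraction_semigroup_generated)
  interpret G: m_dissipative "generator1 generated" by (rule G.generator_m_dissipative)
  show "m_dissipative (generator1 generated)" "m_dissipative A" by unfold_locales
  fix x
  show "G.resolvent 1 x = resolvent 1 x"
  proof (rule dense_eqI[OF dense, where f = "G.resolvent 1" and g = "resolvent 1"])
    fix y assume y: "y \<in> dom A"
    define x where "x = resolvent 1 y"
    have x: "x \<in> dom_square" "x - the (A x) = y"
      using resolvent_in_dom[of 1] resolvent_maps_dom[OF y, of 1] resolvent_eq[of 1 y]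
      by (simp_all add: x_def dom_square_def)
    then show "G.resolvent 1 y = resolvent 1 y"
      using generator_on_dom_square[OF x(1)] x_def
      by (intro G.resolvent_unique) auto
  next
    show "continuous_on UNIV (resolvent 1)" "continuous_on UNIV (G.resolvent 1)"
      by (simp_all add: resolvent_continuous G.resolvent_continuous)
  qed
qed

end

section \<open>Commuting pairs of semigroups\<close>

text \<open>If \<open>X\<^sub>n \<rightarrow> x\<close> within the domain, then \<open>W\<^sub>n = X\<^sub>n - A X\<^sub>n\<close> is a Cauchy sequence because \<open>A\<close>
  is bounded, and \<open>X\<^sub>n = J(1)W\<^sub>n\<close> converges to a value of \<open>J(1)\<close>, which lies in the domain.\<close>

lemma (in densely_defined_m_dissipative) bounded_imp_total:
  assumes "bounded_operator A"
  shows "dom A = UNIV"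
proof -
  obtain C where C: "\<And>x. x \<in> dom A \<Longrightarrow> norm (the (A x)) \<le> C * norm x"
    using assms unfolding bounded_operator_def by blast
  have "x \<in> dom A" for x
  proof -
    have "x \<in> closure (dom A)" using dense by simp
    then obtain X where X: "\<And>n. X n \<in> dom A" "X \<longlonglongrightarrow> x" unfolding closure_sequential by blast
    define W where "W n = X n - the (A (X n))" for n
    have "Cauchy W"
    proof (rule metric_CauchyI)
      fix e :: real assume e: "e > 0"
      have c: "1 + \<bar>C\<bar> > 0" by simp
      obtain M where M: "\<And>m n. m \<ge> M \<Longrightarrow> n \<ge> M \<Longrightarrow> dist (X m) (X n) < e / (1 + \<bar>C\<bar>)"
        using LIMSEQ_imp_Cauchy[OF X(2)] e c unfolding Cauchy_def by (meson divide_pos_pos)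
      have "dist (W m) (W n) < e" if "m \<ge> M" "n \<ge> M" for m n
      proof -
        note d = linear_operator_diff[OF linear_op X(1)[of m] X(1)[of n]]
        have "W m - W n = (X m - X n) - the (A (X m - X n))" by (simp add: W_def d(2))
        then have "norm (W m - W n) \<le> norm (X m - X n) + norm (the (A (X m - X n)))"
          by (simp only: norm_triangle_ineq4)
        also have "\<dots> \<le> norm (X m - X n) + C * norm (X m - X n)" using C[OF d(1)] by simp
        also have "\<dots> \<le> (1 + \<bar>C\<bar>) * norm (X m - X n)"
          by (simp add: distrib_right mult_right_mono)
        also have "\<dots> < e" using M[OF that] c by (simp add: dist_norm pos_less_divide_eq mult.commute)
        finally show ?thesis by (simp add: dist_norm)
      qed
      then show "\<exists>M. \<forall>m\<ge>M. \<forall>n\<ge>M. dist (W m) (W n) < e" by blast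
    qed
    then obtain w where w: "W \<longlonglongrightarrow> w" using Cauchy_convergent convergent_def by blast
    have "X = (\<lambda>n. resolvent 1 (W n))"
      by (rule ext, rule resolvent_unique[symmetric]) (simp_all only: X(1) W_def scaleR_one zero_le_one)
    moreover have "(\<lambda>n. resolvent 1 (W n)) \<longlonglongrightarrow> resolvent 1 w"
      using resolvent_continuous[of 1 UNIV] by (intro continuous_on_tendsto_compose[OF _ w]) auto
    ultimately have "x = resolvent 1 w" using X(2) LIMSEQ_unique by metis
    then show ?thesis using resolvent_in_dom[of 1 w] by simp
  qed
  then show ?thesis by blast
qed

text \<open>Joint strong continuity follows from separate strong continuity, because the first factor
  is contractive: \<open>\<parallel>u(s)(v(t)x - v(t\<^sub>0)x)\<parallel> \<le> \<parallel>v(t)x - v(t\<^sub>0)x\<parallel>\<close>.\<close>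

lemma product_of_commuting_semigroups:
  assumes u: "contraction_semigroup u" and v: "contraction_semigroup v"
    and comm: "\<And>s t. s \<ge> 0 \<Longrightarrow> t \<ge> 0 \<Longrightarrow> u s o\<^sub>L v t = v t o\<^sub>L u s"
  defines "T \<equiv> \<lambda>s t. u s o\<^sub>L v t"
  shows "two_parameter_C0_semigroup T" and "contractive T"
    and "infinitesimal_generator T = (generator1 u, generator1 v)"
proof -
  interpret u: contraction_semigroup u by fact
  interpret v: contraction_semigroup v by fact
  have commute: "blinfun_apply (u s) (blinfun_apply (v t) x) = blinfun_apply (v t) (blinfun_apply (u s) x)"
    if "s \<ge> 0" "t \<ge> 0" for s t x
    using comm[OF that] by (metis blinfun_apply_blinfun_compose)
  have "T (s + s') (t + t') = T s t o\<^sub>L T s' t'" if "s \<ge> 0" "s' \<ge> 0" "t \<ge> 0" "t' \<ge> 0" for s s' t t'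
    by (rule blinfun_eqI) (simp add: T_def u.add v.add commute that)
  moreover have "Vector_Spaces.linear (*\<^sub>C) (*\<^sub>C) (blinfun_apply (T s t))" if "s \<ge> 0" "t \<ge> 0" for s t
    using that by (simp add: clinear_iff T_def blinfun.add_right u.apply_scaleC v.apply_scaleC)
  moreover have "T 0 0 = id_blinfun"
    by (rule blinfun_eqI) (simp add: T_def u.at_zero v.at_zero)
  ultimately have "two_parameter_semigroup T" by (simp add: two_parameter_semigroup_def)
  moreover have "continuous_on ({0..} \<times> {0..}) (\<lambda>(s, t). blinfun_apply (T s t) x)" for x
    unfolding continuous_on_def
  proof
    fix p :: "real \<times> real" assume p: "p \<in> {0..} \<times> {0..}"
    let ?F = "at p within {0..} \<times> {0..}"
    let ?y = "blinfun_apply (v (snd p)) x"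
    have "continuous_on ({0..} \<times> {0..}) (\<lambda>q. blinfun_apply (v (snd q)) x)"
      by (rule continuous_on_compose2[OF v.continuous[of x]]) (auto intro: continuous_intros)
    then have lim_v: "((\<lambda>q. blinfun_apply (v (snd q)) x - ?y) \<longlongrightarrow> 0) ?F"
      using p unfolding continuous_on_def LIM_zero_iff by blast
    have "continuous_on ({0..} \<times> {0..}) (\<lambda>q. blinfun_apply (u (fst q)) ?y)"
      by (rule continuous_on_compose2[OF u.continuous[of ?y]]) (auto intro: continuous_intros)
    then have lim_u: "((\<lambda>q. blinfun_apply (u (fst q)) ?y) \<longlongrightarrow> blinfun_apply (u (fst p)) ?y) ?F"
      using p unfolding continuous_on_def by blast
    have "((\<lambda>q. blinfun_apply (u (fst q)) (blinfun_apply (v (snd q)) x - ?y)) \<longlongrightarrow> 0) ?F"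
    proof (rule Lim_null_comparison[OF _ tendsto_norm_zero[OF lim_v]])
      show "\<forall>\<^sub>F q in ?F. norm (blinfun_apply (u (fst q)) (blinfun_apply (v (snd q)) x - ?y))
          \<le> norm (blinfun_apply (v (snd q)) x - ?y)"
        by (auto simp: eventually_at_filter intro!: always_eventually u.norm_apply_le)
    qed
    from tendsto_add[OF this lim_u]
    show "((\<lambda>(s, t). blinfun_apply (T s t) x) \<longlongrightarrow> (case p of (s, t) \<Rightarrow> blinfun_apply (T s t) x)) ?F"
      by (simp add: T_def case_prod_beta' blinfun.diff_right)
  qed
  ultimately show "two_parameter_C0_semigroup T" by (simp add: two_parameter_C0_semigroup_def)
  have "norm (T s t) \<le> 1" if "s \<ge> 0" "t \<ge> 0" for s t
    unfolding T_def using u.contraction[OF that(1)] v.contraction[OF that(2)]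
    by (intro order_trans[OF norm_blinfun_compose] mult_le_one) auto
  then show "contractive T" by (simp add: contractive_def)
  have "(\<lambda>s. T s 0) = u" "(\<lambda>t. T 0 t) = v"
    by (auto simp: T_def u.at_zero v.at_zero intro!: ext blinfun_eqI)
  then show "infinitesimal_generator T = (generator1 u, generator1 v)"
    by (simp add: infinitesimal_generator_def)
qed

lemma marginal_semigroups:
  assumes T: "two_parameter_C0_semigroup T" "contractive T"
  shows "contraction_semigroup (\<lambda>s. T s 0)" and "contraction_semigroup (\<lambda>t. T 0 t)"
proof -
  have lin: "Vector_Spaces.linear (*\<^sub>C) (*\<^sub>C) (blinfun_apply (T s t))" if "s \<ge> 0" "t \<ge> 0" for s t
    using T that by (simp add: two_parameter_C0_semigroup_def two_parameter_semigroup_def)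
  have zero: "T 0 0 = id_blinfun"
    using T by (simp add: two_parameter_C0_semigroup_def two_parameter_semigroup_def)
  have add: "T (s + s') (t + t') = T s t o\<^sub>L T s' t'" if "s \<ge> 0" "s' \<ge> 0" "t \<ge> 0" "t' \<ge> 0" for s s' t t'
    using T that by (simp add: two_parameter_C0_semigroup_def two_parameter_semigroup_def)
  have norm: "norm (T s t) \<le> 1" if "s \<ge> 0" "t \<ge> 0" for s t
    using T that by (simp add: contractive_def)
  have cont: "continuous_on ({0..} \<times> {0..}) (\<lambda>q. blinfun_apply (T (fst q) (snd q)) x)" for x
    using T by (simp add: two_parameter_C0_semigroup_def case_prod_beta')
  have "continuous_on {0..} (\<lambda>s. blinfun_apply (T s 0) x)" for x
    using continuous_on_compose2[OF cont[of x], where f = "\<lambda>s. (s, 0)" and s = "{0..}"]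
    by (simp add: continuous_on_Pair image_subset_iff)
  then show "contraction_semigroup (\<lambda>s. T s 0)"
    using add[of _ _ 0 0] by (intro contraction_semigroup.intro) (simp_all add: lin zero norm)
  have "continuous_on {0..} (\<lambda>t. blinfun_apply (T 0 t) x)" for x
    using continuous_on_compose2[OF cont[of x], where f = "\<lambda>t. (0, t)" and s = "{0..}"]
    by (simp add: continuous_on_Pair image_subset_iff)
  then show "contraction_semigroup (\<lambda>t. T 0 t)"
    using add[of 0 0] by (intro contraction_semigroup.intro) (simp_all add: lin zero norm)
qed

text \<open>Commutation is transferred from the generators to the semigroups one side at a time: first
  the bounded operator \<open>A\<^sub>2\<close> commutes with \<open>A\<^sub>1\<close>, hence with \<open>u(s)\<close>; then the bounded operator
  \<open>u(s)\<close> commutes with \<open>A\<^sub>2\<close>, hence with \<open>v(t)\<close>.\<close>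

lemma commuting_generators_generate:
  assumes "densely_defined_m_dissipative A\<^sub>1" "densely_defined_m_dissipative A\<^sub>2"
    and bounded: "bounded_operator A\<^sub>2" and comm: "A\<^sub>1 \<circ>\<^sub>m A\<^sub>2 = A\<^sub>2 \<circ>\<^sub>m A\<^sub>1"
  obtains T where "two_parameter_C0_semigroup T" "contractive T" "infinitesimal_generator T = (A\<^sub>1, A\<^sub>2)"
proof -
  interpret A1: densely_defined_m_dissipative A\<^sub>1 by fact
  interpret A2: densely_defined_m_dissipative A\<^sub>2 by fact
  let ?B = "\<lambda>x. the (A\<^sub>2 x)"
  have total: "dom A\<^sub>2 = UNIV" by (rule A2.bounded_imp_total[OF bounded])
  then have Some: "A\<^sub>2 x = Some (?B x)" for x by (metis UNIV_I domD option.sel)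
  obtain C where C: "\<And>x. norm (?B x) \<le> C * norm x"
    using bounded total unfolding bounded_operator_def by auto
  have B: "bounded_linear ?B"
    by (rule bounded_linear_intro[where K = C])
      (use C total in \<open>simp_all add: linear_operator_add(2)[OF A2.linear_op] linear_operator_scaleR(2)[OF A2.linear_op] mult.commute\<close>)
  have B_dom: "?B x \<in> dom A\<^sub>1" "the (A\<^sub>1 (?B x)) = ?B (the (A\<^sub>1 x))" if "x \<in> dom A\<^sub>1" for x
  proof -
    from that obtain y where y: "A\<^sub>1 x = Some y" by auto
    obtain z where "A\<^sub>2 x = Some z" using Some by blast
    then have "(A\<^sub>1 \<circ>\<^sub>m A\<^sub>2) x = A\<^sub>1 (?B x)" by (simp add: map_comp_def)
    moreover have "(A\<^sub>2 \<circ>\<^sub>m A\<^sub>1) x = A\<^sub>2 y" by (simp add: map_comp_def y)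
    ultimately have "A\<^sub>1 (?B x) = Some (?B y)" using comm Some[of y] by metis
    then show "?B x \<in> dom A\<^sub>1" "the (A\<^sub>1 (?B x)) = ?B (the (A\<^sub>1 x))" using y by auto
  qed
  have B_comm: "?B (blinfun_apply (A1.generated s) x) = blinfun_apply (A1.generated s) (?B x)" if "s \<ge> 0" for s x
    by (rule A1.generated_intertwines[OF B B_dom that])
  have "A1.generated s o\<^sub>L A2.generated t = A2.generated t o\<^sub>L A1.generated s" if "s \<ge> 0" "t \<ge> 0" for s t
  proof (rule blinfun_eqI)
    fix x
    have "blinfun_apply (A1.generated s) (blinfun_apply (A2.generated t) x)
        = blinfun_apply (A2.generated t) (blinfun_apply (A1.generated s) x)"
      by (rule A2.generated_intertwines[OF blinfun.bounded_linear_right _ B_comm[OF that(1)] that(2)])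
        (simp add: total)
    then show "blinfun_apply (A1.generated s o\<^sub>L A2.generated t) x
        = blinfun_apply (A2.generated t o\<^sub>L A1.generated s) x" by simp
  qed
  note P = product_of_commuting_semigroups[OF A1.contraction_semigroup_generated
      A2.contraction_semigroup_generated this]
  show thesis using that P unfolding A1.generator_generated A2.generator_generated by blast
qed

theorem theorem2p4:
  fixes A\<^sub>1 A\<^sub>2 :: "'a::complex_banach \<rightharpoonup> 'a"
  assumes "linear_operator A\<^sub>1" and "linear_operator A\<^sub>2"
    and "closure (dom A\<^sub>1) = UNIV" and "closure (dom A\<^sub>2) = UNIV"
  shows "(dissipative A\<^sub>1 \<and> dissipative A\<^sub>2 \<and> bounded_operator A\<^sub>2 \<and>
          (\<exists>l\<^sub>1>0. \<exists>l\<^sub>2>0. shifted_range l\<^sub>1 A\<^sub>1 = UNIV \<and> shifted_range l\<^sub>2 A\<^sub>2 = UNIV) \<and>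
          A\<^sub>1 \<circ>\<^sub>m A\<^sub>2 = A\<^sub>2 \<circ>\<^sub>m A\<^sub>1
          \<longrightarrow> (\<exists>T. two_parameter_C0_semigroup T \<and> contractive T \<and>
                   infinitesimal_generator T = (A\<^sub>1, A\<^sub>2)))
       \<and> ((\<exists>T. two_parameter_C0_semigroup T \<and> contractive T \<and>
               infinitesimal_generator T = (A\<^sub>1, A\<^sub>2))
          \<longrightarrow> (\<forall>l>0. shifted_range l A\<^sub>1 = UNIV \<and> shifted_range l A\<^sub>2 = UNIV) \<and>
              dissipative A\<^sub>1 \<and> dissipative A\<^sub>2 \<and>
              (\<forall>x\<in>dom A\<^sub>1. \<forall>y\<in>dom A\<^sub>2. \<forall>f\<in>duality_set x. \<forall>g\<in>duality_set y.
                 Re (blinfun_apply f (the (A\<^sub>1 x))) \<le> 0 \<and>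
                 Re (blinfun_apply g (the (A\<^sub>2 y))) \<le> 0))"
proof (intro conjI impI)
  assume a: "dissipative A\<^sub>1 \<and> dissipative A\<^sub>2 \<and> bounded_operator A\<^sub>2 \<and>
          (\<exists>l\<^sub>1>0. \<exists>l\<^sub>2>0. shifted_range l\<^sub>1 A\<^sub>1 = UNIV \<and> shifted_range l\<^sub>2 A\<^sub>2 = UNIV) \<and>
          A\<^sub>1 \<circ>\<^sub>m A\<^sub>2 = A\<^sub>2 \<circ>\<^sub>m A\<^sub>1"
  then obtain l\<^sub>1 l\<^sub>2 where l: "l\<^sub>1 > 0" "l\<^sub>2 > 0" "shifted_range l\<^sub>1 A\<^sub>1 = UNIV" "shifted_range l\<^sub>2 A\<^sub>2 = UNIV"
    by blast
  have "densely_defined_m_dissipative A\<^sub>1" "densely_defined_m_dissipative A\<^sub>2"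
    using a assms l dissipative_shifted_range[of A\<^sub>1 l\<^sub>1] dissipative_shifted_range[of A\<^sub>2 l\<^sub>2]
    by (auto intro!: densely_defined_m_dissipative.intro m_dissipative.intro
        densely_defined_m_dissipative_axioms.intro)
  then show "\<exists>T. two_parameter_C0_semigroup T \<and> contractive T \<and> infinitesimal_generator T = (A\<^sub>1, A\<^sub>2)"
    using commuting_generators_generate a by metis
next
  assume "\<exists>T. two_parameter_C0_semigroup T \<and> contractive T \<and> infinitesimal_generator T = (A\<^sub>1, A\<^sub>2)"
  then obtain T where T: "two_parameter_C0_semigroup T" "contractive T"
    and gen: "generator1 (\<lambda>s. T s 0) = A\<^sub>1" "generator1 (\<lambda>t. T 0 t) = A\<^sub>2"
    unfolding infinitesimal_generator_def by auto
  interpret u: contraction_semigroup "\<lambda>s. T s 0" by (rule marginal_semigroups(1)[OF T])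
  interpret v: contraction_semigroup "\<lambda>t. T 0 t" by (rule marginal_semigroups(2)[OF T])
  show "\<forall>l>0. shifted_range l A\<^sub>1 = UNIV \<and> shifted_range l A\<^sub>2 = UNIV"
    using u.generator_range v.generator_range gen by simp
  show "dissipative A\<^sub>1" "dissipative A\<^sub>2"
    using u.generator_dissipative v.generator_dissipative gen by simp_all
  show "\<forall>x\<in>dom A\<^sub>1. \<forall>y\<in>dom A\<^sub>2. \<forall>f\<in>duality_set x. \<forall>g\<in>duality_set y.
      Re (blinfun_apply f (the (A\<^sub>1 x))) \<le> 0 \<and> Re (blinfun_apply g (the (A\<^sub>2 y))) \<le> 0"
    using u.generator_duality v.generator_duality unfolding gen by force
qed

end
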